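(* Let $\mathbb{C}$ be any exact category, and let $F\colon\mathsf{PreOrd}(\mathbb{C})\to\mathsf{ParOrd}(\mathbb{C})$ be the left adjoint of the inclusion $\mathsf{ParOrd}(\mathbb{C})\to\mathsf{PreOrd}(\mathbb{C})$ of internal partial orders into internal preorders. Then $F$ has stable units. That is, for every internal preorder $(X,\rho)$, with unit component $(\pi_X,\overline{\pi}_X)\colon (X,\rho)\to F(X,\rho)=\left(\frac{X}{\sim_\rho},\pi_X(\rho)\right)$, and for every morphism $(f,\overline f)\colon(Z,\sigma)\to F(X,\rho)$ in $\mathsf{PreOrd}(\mathbb{C})$, the functor $F$ preserves the pullback in $\mathsf{PreOrd}(\mathbb{C})$ of $(\pi_X,\overline{\pi}_X)$ along $(f,\overline f)$.
   Context: Exact means Barr-exact: finitely complete, every morphism factors as a regular epimorphism followed by a monomorphism, regular epimorphisms are pullback-stable, and every internal equivalence relation is a kernel pair. An object $(A,\rho)$ of $\mathsf{PreOrd}(\mathbb{C})$ is an object $A$ with a relation (subobject) $\langle r_1,r_2\rangle\colon \rho\to A\times A$ that is reflexive (it contains the diagonal $\Delta_A$) and transitive (there is $\tau\colon\rho\times_A\rho\to\rho$ with $r_1\tau=r_1p_1$, $r_2\tau=r_2p_2$, where $\rho\times_A\rho$ is the pullback of $r_2$ and $r_1$ with projections $p_1,p_2$). A morphism $(A,\rho)\to(B,\sigma)$ is a pair $(f\colon A\to B,\ \overline f\colon\rho\to\sigma)$ with $fr_1=s_1\overline f$ and $fr_2=s_2\overline f$, where $\langle s_1,s_2\rangle\colon\sigma\to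 B\times B$. With $\rho^o=\langle r_2,r_1\rangle$, put $\sim_\rho\,=\rho\wedge\rho^o$, which is an internal equivalence relation on $A$; $(A,\rho)$ is an internal partial order if $\sim_\rho\,=\Delta_A$, and $\mathsf{ParOrd}(\mathbb{C})$ is the full subcategory of internal partial orders. The reflector $F$ sends $(A,\rho)$ to $\left(\frac{A}{\sim_\rho},\pi_A(\rho)\right)$, where $\pi_A\colon A\to\frac{A}{\sim_\rho}$ is the canonical quotient (coequalizer of the projections of $\sim_\rho$) and $\pi_A(\rho)$ is the regular image of $\rho$ along $\pi_A$, i.e. the image of $\rho\to A\times A\xrightarrow{\pi_A\times\pi_A}\frac{A}{\sim_\rho}\times\frac{A}{\sim_\rho}$; the unit is $(\pi_A,\overline{\pi}_A)$ with $\overline{\pi}_A\colon\rho\to\pi_A(\rho)$ the induced regular epimorphism. *)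

theory Defs
  imports Main
begin

section \<open>Categories, functors, adjunctions\<close>

record ('o, 'a) cat =
  obj :: "'o set"
  arr :: "'a set"
  Dom :: "'a \<Rightarrow> 'o"
  Cod :: "'a \<Rightarrow> 'o"
  ident :: "'o \<Rightarrow> 'a"
  comp :: "'a \<Rightarrow> 'a \<Rightarrow> 'a"  (infixr "\<cdot>\<index>" 75)

definition Hom :: "('o, 'a, 'x) cat_scheme \<Rightarrow> 'o \<Rightarrow> 'o \<Rightarrow> 'a set" where
  "Hom C A B = {f \<in> arr C. Dom C f = A \<and> Cod C f = B}"

locale category =
  fixes C :: "('o, 'a) cat" (structure)
  assumes Dom_in [intro, simp]: "f \<in> arr C \<Longrightarrow> Dom C f \<in> obj C"
    and Cod_in [intro, simp]: "f \<in> arr C \<Longrightarrow> Cod C f \<in> obj C"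
    and ident_in [intro, simp]: "A \<in> obj C \<Longrightarrow> ident C A \<in> Hom C A A"
    and comp_in [intro]: "\<lbrakk>f \<in> Hom C A B; g \<in> Hom C B D\<rbrakk> \<Longrightarrow> g \<cdot> f \<in> Hom C A D"
    and ident_left: "f \<in> Hom C A B \<Longrightarrow> ident C B \<cdot> f = f"
    and ident_right: "f \<in> Hom C A B \<Longrightarrow> f \<cdot> ident C A = f"
    and assoc: "\<lbrakk>f \<in> Hom C A B; g \<in> Hom C B D; h \<in> Hom C D E\<rbrakk>
                  \<Longrightarrow> (h \<cdot> g) \<cdot> f = h \<cdot> (g \<cdot> f)"

definition full_subcategory :: "('o, 'a) cat \<Rightarrow> 'o set \<Rightarrow> ('o, 'a) cat" where
  "full_subcategory C S =
     C\<lparr>obj := obj C \<inter> S, arr := {f \<in> arr C. Dom C f \<in> S \<and> Cod C f \<in> S}\<rparr>"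

record ('o, 'a, 'p, 'b) ftor =
  on_obj :: "'o \<Rightarrow> 'p"
  on_arr :: "'a \<Rightarrow> 'b"

definition is_functor :: "('o, 'a) cat \<Rightarrow> ('p, 'b) cat \<Rightarrow> ('o, 'a, 'p, 'b) ftor \<Rightarrow> bool" where
  "is_functor C D F \<longleftrightarrow>
     (\<forall>A\<in>obj C. on_obj F A \<in> obj D \<and> on_arr F (ident C A) = ident D (on_obj F A)) \<and>
     (\<forall>f\<in>arr C. on_arr F f \<in> Hom D (on_obj F (Dom C f)) (on_obj F (Cod C f))) \<and>
     (\<forall>f\<in>arr C. \<forall>g\<in>arr C. Cod C f = Dom C g \<longrightarrow>
        on_arr F (g \<cdot>\<^bsub>C\<^esub> f) = on_arr F g \<cdot>\<^bsub>D\<^esub> on_arr F f)"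

text \<open>The inclusion functor of a full subcategory.\<close>
definition inclusion :: "('o, 'a, 'o, 'a) ftor" where
  "inclusion = \<lparr>on_obj = (\<lambda>A. A), on_arr = (\<lambda>f. f)\<rparr>"

text \<open>\<open>F : C \<rightarrow> D\<close> is left adjoint to \<open>G : D \<rightarrow> C\<close> with unit \<open>\<eta>\<close>: the unit is natural
  and each \<open>\<eta> A : A \<rightarrow> G (F A)\<close> is a universal arrow from \<open>A\<close> to \<open>G\<close>.\<close>
definition left_adjoint ::
  "('o, 'a) cat \<Rightarrow> ('p, 'b) cat \<Rightarrow> ('o, 'a, 'p, 'b) ftor \<Rightarrow> ('p, 'b, 'o, 'a) ftor
     \<Rightarrow> ('o \<Rightarrow> 'a) \<Rightarrow> bool" where
  "left_adjoint C D F G \<eta> \<longleftrightarrow>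
     is_functor C D F \<and> is_functor D C G \<and>
     (\<forall>A\<in>obj C. \<eta> A \<in> Hom C A (on_obj G (on_obj F A))) \<and>
     (\<forall>f\<in>arr C. \<eta> (Cod C f) \<cdot>\<^bsub>C\<^esub> f = on_arr G (on_arr F f) \<cdot>\<^bsub>C\<^esub> \<eta> (Dom C f)) \<and>
     (\<forall>A\<in>obj C. \<forall>B\<in>obj D. \<forall>h\<in>Hom C A (on_obj G B).
        \<exists>!k. k \<in> Hom D (on_obj F A) B \<and> on_arr G k \<cdot>\<^bsub>C\<^esub> \<eta> A = h)"

section \<open>Limits, monomorphisms, regular epimorphisms\<close>

definition is_cone ::
  "('j, 'k) cat \<Rightarrow> ('o, 'a) cat \<Rightarrow> ('j, 'k, 'o, 'a) ftor \<Rightarrow> 'o \<Rightarrow> ('j \<Rightarrow> 'a) \<Rightarrow> bool" where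
  "is_cone J C D L l \<longleftrightarrow>
     L \<in> obj C \<and> (\<forall>j\<in>obj J. l j \<in> Hom C L (on_obj D j)) \<and>
     (\<forall>a\<in>arr J. on_arr D a \<cdot>\<^bsub>C\<^esub> l (Dom J a) = l (Cod J a))"

definition is_limit ::
  "('j, 'k) cat \<Rightarrow> ('o, 'a) cat \<Rightarrow> ('j, 'k, 'o, 'a) ftor \<Rightarrow> 'o \<Rightarrow> ('j \<Rightarrow> 'a) \<Rightarrow> bool" where
  "is_limit J C D L l \<longleftrightarrow>
     is_cone J C D L l \<and>
     (\<forall>M m. is_cone J C D M m \<longrightarrow>
        (\<exists>!h. h \<in> Hom C M L \<and> (\<forall>j\<in>obj J. l j \<cdot>\<^bsub>C\<^esub> h = m j)))"

text \<open>Every finite category is isomorphic to one whose objects and arrows are natural numbers,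
  so it suffices to quantify over shapes of this type.\<close>
definition finitely_complete :: "('o, 'a) cat \<Rightarrow> bool" where
  "finitely_complete C \<longleftrightarrow>
     (\<forall>(J :: (nat, nat) cat) D. category J \<and> finite (arr J) \<and> is_functor J C D \<longrightarrow>
        (\<exists>L l. is_limit J C D L l))"

text \<open>The square \<open>f p = g q\<close> is a pullback; \<open>q\<close> is the pullback of \<open>f\<close> along \<open>g\<close>.\<close>
definition is_pullback :: "('o, 'a) cat \<Rightarrow> 'a \<Rightarrow> 'a \<Rightarrow> 'a \<Rightarrow> 'a \<Rightarrow> bool" where
  "is_pullback C f g p q \<longleftrightarrow>
     f \<in> arr C \<and> g \<in> arr C \<and> Cod C f = Cod C g \<and>
     p \<in> Hom C (Dom C p) (Dom C f) \<and> q \<in> Hom C (Dom C p) (Dom C g) \<and>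
     f \<cdot>\<^bsub>C\<^esub> p = g \<cdot>\<^bsub>C\<^esub> q \<and>
     (\<forall>T\<in>obj C. \<forall>u\<in>Hom C T (Dom C f). \<forall>v\<in>Hom C T (Dom C g).
        f \<cdot>\<^bsub>C\<^esub> u = g \<cdot>\<^bsub>C\<^esub> v \<longrightarrow>
        (\<exists>!h. h \<in> Hom C T (Dom C p) \<and> p \<cdot>\<^bsub>C\<^esub> h = u \<and> q \<cdot>\<^bsub>C\<^esub> h = v))"

definition is_kernel_pair :: "('o, 'a) cat \<Rightarrow> 'a \<Rightarrow> 'a \<Rightarrow> 'a \<Rightarrow> bool" where
  "is_kernel_pair C f r1 r2 \<longleftrightarrow> is_pullback C f f r1 r2"

definition is_product :: "('o, 'a) cat \<Rightarrow> 'o \<Rightarrow> 'o \<Rightarrow> 'o \<Rightarrow> 'a \<Rightarrow> 'a \<Rightarrow> bool" where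
  "is_product C A B P p q \<longleftrightarrow>
     A \<in> obj C \<and> B \<in> obj C \<and> P \<in> obj C \<and> p \<in> Hom C P A \<and> q \<in> Hom C P B \<and>
     (\<forall>T\<in>obj C. \<forall>u\<in>Hom C T A. \<forall>v\<in>Hom C T B.
        \<exists>!h. h \<in> Hom C T P \<and> p \<cdot>\<^bsub>C\<^esub> h = u \<and> q \<cdot>\<^bsub>C\<^esub> h = v)"

definition is_mono :: "('o, 'a) cat \<Rightarrow> 'a \<Rightarrow> bool" where
  "is_mono C m \<longleftrightarrow>
     m \<in> arr C \<and>
     (\<forall>T\<in>obj C. \<forall>u\<in>Hom C T (Dom C m). \<forall>v\<in>Hom C T (Dom C m).
        m \<cdot>\<^bsub>C\<^esub> u = m \<cdot>\<^bsub>C\<^esub> v \<longrightarrow> u = v)"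

definition is_coequalizer :: "('o, 'a) cat \<Rightarrow> 'a \<Rightarrow> 'a \<Rightarrow> 'a \<Rightarrow> bool" where
  "is_coequalizer C u v q \<longleftrightarrow>
     u \<in> arr C \<and> v \<in> Hom C (Dom C u) (Cod C u) \<and>
     q \<in> Hom C (Cod C u) (Cod C q) \<and> q \<cdot>\<^bsub>C\<^esub> u = q \<cdot>\<^bsub>C\<^esub> v \<and>
     (\<forall>T\<in>obj C. \<forall>h\<in>Hom C (Cod C u) T. h \<cdot>\<^bsub>C\<^esub> u = h \<cdot>\<^bsub>C\<^esub> v \<longrightarrow>
        (\<exists>!k. k \<in> Hom C (Cod C q) T \<and> k \<cdot>\<^bsub>C\<^esub> q = h))"

definition is_regular_epi :: "('o, 'a) cat \<Rightarrow> 'a \<Rightarrow> bool" where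
  "is_regular_epi C q \<longleftrightarrow> (\<exists>u v. is_coequalizer C u v q)"

section \<open>Internal relations\<close>

text \<open>A relation \<open>\<langle>r1, r2\<rangle> : R \<rightarrow> A \<times> A\<close> is stored as \<open>IRel A r1 r2\<close>, with \<open>R\<close> the domain
  of \<open>r1\<close>; as usual a subobject is handled through a representing monomorphism.\<close>
datatype ('o, 'a) irel = IRel (carrier: 'o) (fst_proj: 'a) (snd_proj: 'a)

definition graph :: "('o, 'a) cat \<Rightarrow> ('o, 'a) irel \<Rightarrow> 'o" where
  "graph C \<rho> = Dom C (fst_proj \<rho>)"

definition is_relation :: "('o, 'a) cat \<Rightarrow> ('o, 'a) irel \<Rightarrow> bool" where
  "is_relation C \<rho> \<longleftrightarrow>
     fst_proj \<rho> \<in> Hom C (graph C \<rho>) (carrier \<rho>) \<and>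
     snd_proj \<rho> \<in> Hom C (graph C \<rho>) (carrier \<rho>) \<and>
     (\<exists>P p q m. is_product C (carrier \<rho>) (carrier \<rho>) P p q \<and>
        m \<in> Hom C (graph C \<rho>) P \<and> p \<cdot>\<^bsub>C\<^esub> m = fst_proj \<rho> \<and> q \<cdot>\<^bsub>C\<^esub> m = snd_proj \<rho> \<and>
        is_mono C m)"

text \<open>The order of subobjects of \<open>A \<times> A\<close>: \<open>\<rho>\<close> factors through \<open>\<sigma>\<close>.\<close>
definition rel_le :: "('o, 'a) cat \<Rightarrow> ('o, 'a) irel \<Rightarrow> ('o, 'a) irel \<Rightarrow> bool" where
  "rel_le C \<rho> \<sigma> \<longleftrightarrow>
     carrier \<rho> = carrier \<sigma> \<and>
     (\<exists>h\<in>Hom C (graph C \<rho>) (graph C \<sigma>).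
        fst_proj \<sigma> \<cdot>\<^bsub>C\<^esub> h = fst_proj \<rho> \<and> snd_proj \<sigma> \<cdot>\<^bsub>C\<^esub> h = snd_proj \<rho>)"

definition diagonal :: "('o, 'a) cat \<Rightarrow> 'o \<Rightarrow> ('o, 'a) irel" where
  "diagonal C A = IRel A (ident C A) (ident C A)"

definition opposite :: "('o, 'a) irel \<Rightarrow> ('o, 'a) irel" where
  "opposite \<rho> = IRel (carrier \<rho>) (snd_proj \<rho>) (fst_proj \<rho>)"

text \<open>\<open>\<theta>\<close> represents the meet of \<open>\<rho>\<close> and \<open>\<sigma>\<close> in the order of subobjects of \<open>A \<times> A\<close>.\<close>
definition is_meet ::
  "('o, 'a) cat \<Rightarrow> ('o, 'a) irel \<Rightarrow> ('o, 'a) irel \<Rightarrow> ('o, 'a) irel \<Rightarrow> bool" where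
  "is_meet C \<rho> \<sigma> \<theta> \<longleftrightarrow>
     is_relation C \<theta> \<and> rel_le C \<theta> \<rho> \<and> rel_le C \<theta> \<sigma> \<and>
     (\<forall>\<kappa>. is_relation C \<kappa> \<and> rel_le C \<kappa> \<rho> \<and> rel_le C \<kappa> \<sigma> \<longrightarrow> rel_le C \<kappa> \<theta>)"

definition is_reflexive :: "('o, 'a) cat \<Rightarrow> ('o, 'a) irel \<Rightarrow> bool" where
  "is_reflexive C \<rho> \<longleftrightarrow> rel_le C (diagonal C (carrier \<rho>)) \<rho>"

definition is_symmetric :: "('o, 'a) cat \<Rightarrow> ('o, 'a) irel \<Rightarrow> bool" where
  "is_symmetric C \<rho> \<longleftrightarrow> rel_le C \<rho> (opposite \<rho>)"

definition is_transitive :: "('o, 'a) cat \<Rightarrow> ('o, 'a) irel \<Rightarrow> bool" where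
  "is_transitive C \<rho> \<longleftrightarrow>
     (\<exists>p1 p2 t. is_pullback C (snd_proj \<rho>) (fst_proj \<rho>) p1 p2 \<and>
        t \<in> Hom C (Dom C p1) (graph C \<rho>) \<and>
        fst_proj \<rho> \<cdot>\<^bsub>C\<^esub> t = fst_proj \<rho> \<cdot>\<^bsub>C\<^esub> p1 \<and>
        snd_proj \<rho> \<cdot>\<^bsub>C\<^esub> t = snd_proj \<rho> \<cdot>\<^bsub>C\<^esub> p2)"

definition is_equivalence :: "('o, 'a) cat \<Rightarrow> ('o, 'a) irel \<Rightarrow> bool" where
  "is_equivalence C \<rho> \<longleftrightarrow>
     is_relation C \<rho> \<and> is_reflexive C \<rho> \<and> is_symmetric C \<rho> \<and> is_transitive C \<rho>"

text \<open>Exactness in the sense of Barr.\<close>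
locale exact_category = category C for C :: "('o, 'a) cat" (structure) +
  assumes finitely_complete: "finitely_complete C"
    and factorization: "f \<in> arr C \<Longrightarrow>
      \<exists>e m. is_regular_epi C e \<and> is_mono C m \<and> Cod C e = Dom C m \<and> f = m \<cdot> e"
    and regular_epi_stable:
      "\<lbrakk>is_pullback C f g p q; is_regular_epi C f\<rbrakk> \<Longrightarrow> is_regular_epi C q"
    and equivalence_effective: "is_equivalence C \<rho> \<Longrightarrow>
      \<exists>f. is_kernel_pair C f (fst_proj \<rho>) (snd_proj \<rho>)"

section \<open>Internal preorders and internal partial orders\<close>

definition is_preorder :: "('o, 'a) cat \<Rightarrow> ('o, 'a) irel \<Rightarrow> bool" where
  "is_preorder C \<rho> \<longleftrightarrow> is_relation C \<rho> \<and> is_reflexive C \<rho> \<and> is_transitive C \<rho>"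

text \<open>\<open>\<theta>\<close> represents \<open>\<rho> \<and> \<rho>\<^sup>o\<close>.\<close>
definition is_sim :: "('o, 'a) cat \<Rightarrow> ('o, 'a) irel \<Rightarrow> ('o, 'a) irel \<Rightarrow> bool" where
  "is_sim C \<rho> \<theta> \<longleftrightarrow> is_meet C \<rho> (opposite \<rho>) \<theta>"

definition is_partial_order :: "('o, 'a) cat \<Rightarrow> ('o, 'a) irel \<Rightarrow> bool" where
  "is_partial_order C \<rho> \<longleftrightarrow> is_preorder C \<rho> \<and> is_sim C \<rho> (diagonal C (carrier \<rho>))"

datatype ('o, 'a) rel_mor =
  RMor (source: "('o, 'a) irel") (target: "('o, 'a) irel") (base: 'a) (lift: 'a)

definition is_rel_mor :: "('o, 'a) cat \<Rightarrow> ('o, 'a) rel_mor \<Rightarrow> bool" where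
  "is_rel_mor C h \<longleftrightarrow>
     base h \<in> Hom C (carrier (source h)) (carrier (target h)) \<and>
     lift h \<in> Hom C (graph C (source h)) (graph C (target h)) \<and>
     base h \<cdot>\<^bsub>C\<^esub> fst_proj (source h) = fst_proj (target h) \<cdot>\<^bsub>C\<^esub> lift h \<and>
     base h \<cdot>\<^bsub>C\<^esub> snd_proj (source h) = snd_proj (target h) \<cdot>\<^bsub>C\<^esub> lift h"

definition PreOrd :: "('o, 'a) cat \<Rightarrow> (('o, 'a) irel, ('o, 'a) rel_mor) cat" where
  "PreOrd C = \<lparr>
     obj = {\<rho>. is_preorder C \<rho>},
     arr = {h. is_preorder C (source h) \<and> is_preorder C (target h) \<and> is_rel_mor C h},
     Dom = source,
     Cod = target,
     ident = (\<lambda>\<rho>. RMor \<rho> \<rho> (ident C (carrier \<rho>)) (ident C (graph C \<rho>))),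
     comp = (\<lambda>k h. RMor (source h) (target k) (base k \<cdot>\<^bsub>C\<^esub> base h) (lift k \<cdot>\<^bsub>C\<^esub> lift h))\<rparr>"

lemma Hom_PreOrd:
  "h \<in> Hom (PreOrd C) \<rho> \<sigma> \<longleftrightarrow>
     is_preorder C \<rho> \<and> is_preorder C \<sigma> \<and> is_rel_mor C h \<and> source h = \<rho> \<and> target h = \<sigma>"
  by (auto simp: Hom_def PreOrd_def)

lemma PreOrd_simps:
  "obj (PreOrd C) = {\<rho>. is_preorder C \<rho>}"
  "Dom (PreOrd C) h = source h" "Cod (PreOrd C) h = target h"
  "ident (PreOrd C) \<rho> = RMor \<rho> \<rho> (ident C (carrier \<rho>)) (ident C (graph C \<rho>))"
  "k \<cdot>\<^bsub>PreOrd C\<^esub> h =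
     RMor (source h) (target k) (base k \<cdot>\<^bsub>C\<^esub> base h) (lift k \<cdot>\<^bsub>C\<^esub> lift h)"
  by (simp_all add: PreOrd_def)

lemma category_PreOrd:
  assumes "category C"
  shows "category (PreOrd C)"
proof -
  interpret category C by fact
  have rc: "carrier \<rho> \<in> obj C" "graph C \<rho> \<in> obj C"
      "fst_proj \<rho> \<in> Hom C (graph C \<rho>) (carrier \<rho>)"
      "snd_proj \<rho> \<in> Hom C (graph C \<rho>) (carrier \<rho>)" if "is_preorder C \<rho>" for \<rho>
    using that Dom_in[of "fst_proj \<rho>"] Cod_in[of "fst_proj \<rho>"]
    unfolding is_preorder_def is_relation_def Hom_def by auto
  show ?thesis
  proof (unfold_locales, goal_cases)
    case (3 A)
    then have "is_preorder C A" by (simp add: PreOrd_def)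
    with rc[of A] have "is_rel_mor C (ident (PreOrd C) A)"
      by (simp add: PreOrd_simps is_rel_mor_def ident_left[of _ "graph C A"]
          ident_right[of _ _ "carrier A"])
    with \<open>is_preorder C A\<close> show ?case by (simp add: Hom_PreOrd PreOrd_simps)
  next
    case (4 f A B g D)
    then have P: "is_preorder C A" "is_preorder C B" "is_preorder C D"
      and s: "source f = A" "target f = B" "source g = B" "target g = D"
      and m: "is_rel_mor C f" "is_rel_mor C g"
      by (auto simp: Hom_PreOrd)
    have sq: "(b' \<cdot>\<^bsub>C\<^esub> b) \<cdot>\<^bsub>C\<^esub> r = t \<cdot>\<^bsub>C\<^esub> (l' \<cdot>\<^bsub>C\<^esub> l)"
      if "b \<in> Hom C X Y" "b' \<in> Hom C Y Z" "l \<in> Hom C U V" "l' \<in> Hom C V W"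
        "r \<in> Hom C U X" "s \<in> Hom C V Y" "t \<in> Hom C W Z"
        "b \<cdot>\<^bsub>C\<^esub> r = s \<cdot>\<^bsub>C\<^esub> l" "b' \<cdot>\<^bsub>C\<^esub> s = t \<cdot>\<^bsub>C\<^esub> l'" for b b' l l' r s t U V W X Y Z
      using assoc[OF that(5,1,2)] assoc[OF that(3,6,2)] assoc[OF that(3,4,7)] that(8,9) by simp
    have "is_rel_mor C (RMor A D (base g \<cdot>\<^bsub>C\<^esub> base f) (lift g \<cdot>\<^bsub>C\<^esub> lift f))"
      using m s rc[OF P(1)] rc[OF P(2)] rc[OF P(3)] unfolding is_rel_mor_def
      by (auto intro: comp_in sq)
    with P s show ?case by (simp add: Hom_PreOrd PreOrd_simps)
  next
    case (5 f A B)
    then show ?case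
      by (cases f) (auto simp: Hom_PreOrd PreOrd_simps is_rel_mor_def intro: ident_left)
  next
    case (6 f A B)
    then show ?case
      by (cases f) (auto simp: Hom_PreOrd PreOrd_simps is_rel_mor_def intro: ident_right)
  next
    case (7 f A B g D h E)
    then have "is_rel_mor C f" "is_rel_mor C g" "is_rel_mor C h"
      "target f = source g" "target g = source h"
      by (auto simp: Hom_PreOrd)
    then show ?case by (auto simp: PreOrd_simps is_rel_mor_def intro: assoc)
  qed (auto simp: PreOrd_def)
qed

definition ParOrd :: "('o, 'a) cat \<Rightarrow> (('o, 'a) irel, ('o, 'a) rel_mor) cat" where
  "ParOrd C = full_subcategory (PreOrd C) {\<rho>. is_partial_order C \<rho>}"

section \<open>The reflection and stability of its units\<close>

text \<open>\<open>\<sigma>\<close>, with \<open>e\<close>, is the regular image of \<open>\<rho>\<close> along \<open>q\<close>, i.e. the image of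
  \<open>\<langle>q r1, q r2\<rangle> : R \<rightarrow> B \<times> B\<close>.\<close>
definition is_regular_image ::
  "('o, 'a) cat \<Rightarrow> 'a \<Rightarrow> ('o, 'a) irel \<Rightarrow> ('o, 'a) irel \<Rightarrow> 'a \<Rightarrow> bool" where
  "is_regular_image C q \<rho> \<sigma> e \<longleftrightarrow>
     q \<in> Hom C (carrier \<rho>) (carrier \<sigma>) \<and> is_relation C \<sigma> \<and>
     e \<in> Hom C (graph C \<rho>) (graph C \<sigma>) \<and> is_regular_epi C e \<and>
     fst_proj \<sigma> \<cdot>\<^bsub>C\<^esub> e = q \<cdot>\<^bsub>C\<^esub> fst_proj \<rho> \<and>
     snd_proj \<sigma> \<cdot>\<^bsub>C\<^esub> e = q \<cdot>\<^bsub>C\<^esub> snd_proj \<rho>"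

text \<open>\<open>h\<close> is the canonical morphism from \<open>(A, \<rho>)\<close> to \<open>(A / \<sim>, \<pi>(\<rho>))\<close>; quotient and image
  are determined up to isomorphism only.\<close>
definition is_canonical_quotient ::
  "('o, 'a) cat \<Rightarrow> ('o, 'a) irel \<Rightarrow> ('o, 'a) rel_mor \<Rightarrow> bool" where
  "is_canonical_quotient C \<rho> h \<longleftrightarrow>
     source h = \<rho> \<and>
     (\<exists>\<theta>. is_sim C \<rho> \<theta> \<and> is_coequalizer C (fst_proj \<theta>) (snd_proj \<theta>) (base h)) \<and>
     is_regular_image C (base h) \<rho> (target h) (lift h)"

definition preserves_pullback_of ::
  "('o, 'a) cat \<Rightarrow> ('p, 'b) cat \<Rightarrow> ('o, 'a, 'p, 'b) ftor \<Rightarrow> 'a \<Rightarrow> 'a \<Rightarrow> bool" where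
  "preserves_pullback_of C D F f g \<longleftrightarrow>
     (\<forall>p q. is_pullback C f g p q \<longrightarrow>
        is_pullback D (on_arr F f) (on_arr F g) (on_arr F p) (on_arr F q))"

text \<open>For a reflector \<open>F : C \<rightarrow> D\<close> onto a full subcategory \<open>D\<close> of \<open>C\<close>, with unit \<open>\<eta>\<close>.\<close>
definition has_stable_units ::
  "('o, 'a) cat \<Rightarrow> ('o, 'a) cat \<Rightarrow> ('o, 'a, 'o, 'a) ftor \<Rightarrow> ('o \<Rightarrow> 'a) \<Rightarrow> bool" where
  "has_stable_units C D F \<eta> \<longleftrightarrow>
     (\<forall>X\<in>obj C. \<forall>Z\<in>obj C. \<forall>f\<in>Hom C Z (on_obj F X). preserves_pullback_of C D F (\<eta> X) f)"

end

(* Reasoning with generalized elements: a regular epimorphism has local preimages, and membership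
   in a relation descends along regular epimorphisms.  The quotient of (X, rho) exists because ~ is
   effective; it reflects the order, and it has the universal property of the unit, so the unit is
   isomorphic to it.

   For stable units let q : P -> Z be the pullback of the unit along f.  The reflection of the unit
   is invertible, so it suffices that F q is invertible, i.e. that morphisms from P to a partial
   order factor uniquely through q.  The base of q is a regular epimorphism; two elements of P with
   the same image in Z are equivalent in P, hence identified by any such morphism; and since the
   order on F(X, rho) is an image, related elements of Z lift locally to related elements of P. *)
theory Submission imports Defs begin

section \<open>Categories and finite limits\<close>

text \<open>The reflector, its unit and the pullback square are given only by universal properties,
  and no limits are constructed in \<open>PreOrd C\<close>. The part on reflections is therefore
  pure category theory, valid for any reflective full subcategory; all it asks of \<open>q\<close>
  is that arrows into objects of the subcategory extend uniquely along \<open>q\<close>. For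
  preorders, the underlying object of a given pullback is probed by discrete preorders, and its
  order is shown to be large enough by comparison with an explicitly built preorder on the same
  object. Exactness enters in three ways: factorization yields the quotient map and the image order,
  pullback stability yields local preimages, and effectiveness ensures that the quotient map
  identifies equivalent elements only. The last point is what lets the quotient reflect the
  order.\<close>

context category
begin

lemma comp_arr [simp]:
  assumes "f \<in> arr C" "g \<in> arr C" "Dom C g = Cod C f"
  shows "g \<cdot> f \<in> arr C" "Dom C (g \<cdot> f) = Dom C f" "Cod C (g \<cdot> f) = Cod C g"
  using comp_in[of f "Dom C f" "Cod C f" g "Cod C g"] assms by (auto simp: Hom_def)

lemma comp_assoc:
  assumes "f \<in> arr C" "g \<in> arr C" "h \<in> arr C" "Dom C g = Cod C f" "Dom C h = Cod C g"
  shows "(h \<cdot> g) \<cdot> f = h \<cdot> (g \<cdot> f)"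
  using assoc[of f "Dom C f" "Cod C f" g "Cod C g" h "Cod C h"] assms by (auto simp: Hom_def)

lemma Hom_obj: "f \<in> Hom C A B \<Longrightarrow> A \<in> obj C \<and> B \<in> obj C"
  by (auto simp: Hom_def)

lemma ident_arr [simp]:
  assumes "A \<in> obj C"
  shows "ident C A \<in> arr C" "Dom C (ident C A) = A" "Cod C (ident C A) = A"
  using ident_in[OF assms] by (auto simp: Hom_def)

lemma pullbackI:
  assumes "f \<in> Hom C A D" "g \<in> Hom C B D" "p \<in> Hom C P A" "q \<in> Hom C P B" "f \<cdot> p = g \<cdot> q"
    and "\<And>T u v. u \<in> Hom C T A \<Longrightarrow> v \<in> Hom C T B \<Longrightarrow> f \<cdot> u = g \<cdot> v \<Longrightarrow>
      \<exists>h \<in> Hom C T P. p \<cdot> h = u \<and> q \<cdot> h = v"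
    and "\<And>T h h'. h \<in> Hom C T P \<Longrightarrow> h' \<in> Hom C T P \<Longrightarrow> p \<cdot> h = p \<cdot> h' \<Longrightarrow> q \<cdot> h = q \<cdot> h' \<Longrightarrow> h = h'"
  shows "is_pullback C f g p q"
proof -
  have "\<exists>!h. h \<in> Hom C T P \<and> p \<cdot> h = u \<and> q \<cdot> h = v"
    if "u \<in> Hom C T A" "v \<in> Hom C T B" "f \<cdot> u = g \<cdot> v" for T u v
    using assms(6)[OF that] assms(7)[of _ T] by metis
  moreover have "A = Dom C f" "B = Dom C g" "P = Dom C p" "f \<in> arr C" "g \<in> arr C" "Cod C f = Cod C g"
    using assms(1-4) by (auto simp: Hom_def)
  ultimately show ?thesis using assms(3-5) unfolding is_pullback_def by blast
qed

lemma pullback_lift: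
  assumes "is_pullback C f g p q" "u \<in> Hom C T (Dom C f)" "v \<in> Hom C T (Dom C g)" "f \<cdot> u = g \<cdot> v"
  obtains h where "h \<in> Hom C T (Dom C p)" "p \<cdot> h = u" "q \<cdot> h = v"
proof -
  have "T \<in> obj C" using assms(2) Hom_obj by blast
  then show ?thesis using assms that unfolding is_pullback_def by blast
qed

lemma pullback_typing:
  assumes "is_pullback C f g p q"
  shows "p \<in> Hom C (Dom C p) (Dom C f)" "q \<in> Hom C (Dom C p) (Dom C g)" "f \<cdot> p = g \<cdot> q"
  using assms unfolding is_pullback_def by auto

lemma pullback_unique:
  assumes "is_pullback C f g p q" "h \<in> Hom C T (Dom C p)" "h' \<in> Hom C T (Dom C p)"
    "p \<cdot> h = p \<cdot> h'" "q \<cdot> h = q \<cdot> h'"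
  shows "h = h'"
proof -
  have fg: "f \<in> arr C" "g \<in> arr C" "Cod C f = Cod C g" "f \<cdot> p = g \<cdot> q"
    "p \<in> Hom C (Dom C p) (Dom C f)" "q \<in> Hom C (Dom C p) (Dom C g)"
    using assms(1) unfolding is_pullback_def by auto
  have "f \<cdot> (p \<cdot> h) = g \<cdot> (q \<cdot> h)"
    using fg assms(2) comp_assoc[of h p f] comp_assoc[of h q g] by (auto simp: Hom_def)
  moreover have "p \<cdot> h \<in> Hom C T (Dom C f)" "q \<cdot> h \<in> Hom C T (Dom C g)"
    using fg assms(2) by (auto simp: Hom_def)
  moreover have "T \<in> obj C" using assms(2) Hom_obj by blast
  ultimately have "\<exists>!k. k \<in> Hom C T (Dom C p) \<and> p \<cdot> k = p \<cdot> h \<and> q \<cdot> k = q \<cdot> h"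
    using assms(1) unfolding is_pullback_def by blast
  then show ?thesis using assms by metis
qed

lemma ex_pullback:
  assumes fc: "finitely_complete C" and f: "f \<in> Hom C A D" and g: "g \<in> Hom C B D"
  obtains p q where "is_pullback C f g p q"
proof -
  \<comment> \<open>The cospan shape: 0, 1, 2 are objects and their identities, 3 goes from 0 to 2,
    and 4 from 1 to 2. In a composable pair at least one arrow is an identity, and its number does
    not exceed the other one; hence \<open>max\<close> is composition, and associativity comes for
    free.\<close>
  define J :: "(nat, nat) cat" where
    "J = \<lparr>obj = {0,1,2}, arr = {0,1,2,3,4},
      Dom = (\<lambda>a. if a = 3 then 0 else if a = 4 then 1 else a),
      Cod = (\<lambda>a. if a = 3 \<or> a = 4 then 2 else a), ident = (\<lambda>n. n),
      comp = max\<rparr>"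
  define G :: "(nat, nat, 'o, 'a) ftor" where
    "G = \<lparr>on_obj = (\<lambda>n. if n = 0 then A else if n = 1 then B else D),
      on_arr = (\<lambda>n. if n = 0 then ident C A else if n = 1 then ident C B
        else if n = 2 then ident C D else if n = 3 then f else g)\<rparr>"
  have o: "A \<in> obj C" "B \<in> obj C" "D \<in> obj C" using f g Hom_obj by blast+
  have J: "category J"
  proof (unfold_locales, goal_cases)
    case (4 a i j b k)
    then show ?case by (simp only: J_def Hom_def cat.simps mem_Collect_eq) (elim conjE insertE emptyE; simp)
  next
    case (7 a i j b k c l)
    show ?case by (simp add: J_def max.assoc)
  qed (auto simp: J_def Hom_def)
  moreover have "finite (arr J)" by (simp add: J_def)
  moreover have "is_functor J C G"
    using o f g unfolding is_functor_def J_def G_def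
    by (simp add: ident_left[OF f] ident_right[OF f] ident_left[OF g] ident_right[OF g]
      ident_left[OF ident_in])
  ultimately obtain L l where lim: "is_limit J C G L l"
    using fc unfolding finitely_complete_def by blast
  \<comment> \<open>The leg at the corner 2 is forced by the leg at 0, so a cone is just a
    commutative square over \<open>f\<close> and \<open>g\<close>.\<close>
  have cone: "is_cone J C G M m \<longleftrightarrow> m 0 \<in> Hom C M A \<and> m 1 \<in> Hom C M B \<and>
    m 2 = f \<cdot> m 0 \<and> f \<cdot> m 0 = g \<cdot> m 1" for M m
  proof -
    have "is_cone J C G M m \<longleftrightarrow> M \<in> obj C \<and> m 0 \<in> Hom C M A \<and> m 1 \<in> Hom C M B \<and> m 2 \<in> Hom C M D \<and>
      ident C A \<cdot> m 0 = m 0 \<and> ident C B \<cdot> m 1 = m 1 \<and> ident C D \<cdot> m 2 = m 2 \<and>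
      f \<cdot> m 0 = m 2 \<and> g \<cdot> m 1 = m 2"
      unfolding is_cone_def J_def G_def by auto
    then show ?thesis
      using ident_left[of "m 0" M A] ident_left[of "m 1" M B] ident_left[of "m 2" M D]
        comp_in[OF _ f, of "m 0" M] Hom_obj[of "m 0" M A] by metis
  qed
  have "is_pullback C f g (l 0) (l 1)"
  proof (rule pullbackI[OF f g])
    have c: "is_cone J C G L l" using lim unfolding is_limit_def by blast
    then show "l 0 \<in> Hom C L A" "l 1 \<in> Hom C L B" "f \<cdot> l 0 = g \<cdot> l 1"
      unfolding cone by auto
    fix T
    {
      fix u v assume "u \<in> Hom C T A" "v \<in> Hom C T B" "f \<cdot> u = g \<cdot> v"
      then have "is_cone J C G T (\<lambda>n. if n = 0 then u else if n = 1 then v else f \<cdot> u)"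
        unfolding cone by simp
      then have "\<exists>h\<in>Hom C T L. \<forall>j\<in>obj J. l j \<cdot> h = (if j = 0 then u else if j = 1 then v else f \<cdot> u)"
        using lim unfolding is_limit_def by blast
      then show "\<exists>h\<in>Hom C T L. l 0 \<cdot> h = u \<and> l 1 \<cdot> h = v"
        by (auto simp: J_def)
    }
    fix h h' assume h: "h \<in> Hom C T L" "h' \<in> Hom C T L" "l 0 \<cdot> h = l 0 \<cdot> h'" "l 1 \<cdot> h = l 1 \<cdot> h'"
    have l: "l 0 \<in> Hom C L A" "l 1 \<in> Hom C L B" "l 2 = f \<cdot> l 0" "f \<cdot> l 0 = g \<cdot> l 1"
      using c unfolding cone by auto
    have e: "(f \<cdot> l 0) \<cdot> k = f \<cdot> (l 0 \<cdot> k)" "(g \<cdot> l 1) \<cdot> k = g \<cdot> (l 1 \<cdot> k)" if "k \<in> Hom C T L" for k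
      using assoc[OF that l(1) f] assoc[OF that l(2) g] by blast+
    have "is_cone J C G T (\<lambda>j. l j \<cdot> h)"
      unfolding cone using h l e[OF h(1)] by auto
    then have "\<exists>!k. k \<in> Hom C T L \<and> (\<forall>j\<in>obj J. l j \<cdot> k = l j \<cdot> h)"
      using lim unfolding is_limit_def by blast
    moreover have "\<forall>j\<in>obj J. l j \<cdot> h' = l j \<cdot> h"
      using h l e[OF h(1)] e[OF h(2)] by (auto simp: J_def)
    ultimately show "h = h'" using h by blast
  qed
  then show ?thesis using that by blast
qed

lemma ex_product:
  assumes fc: "finitely_complete C" and o: "A \<in> obj C" "B \<in> obj C"
  obtains P p q where "is_product C A B P p q"
proof -
  \<comment> \<open>The discrete shape on two objects. Only an identity with itself is composable,
    so returning either argument is a correct composition.\<close>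
  define J :: "(nat, nat) cat" where
    "J = \<lparr>obj = {0,1}, arr = {0,1}, Dom = (\<lambda>a. a), Cod = (\<lambda>a. a), ident = (\<lambda>n. n),
      comp = (\<lambda>b a. a)\<rparr>"
  define G :: "(nat, nat, 'o, 'a) ftor" where
    "G = \<lparr>on_obj = (\<lambda>n. if n = 0 then A else B),
      on_arr = (\<lambda>n. if n = 0 then ident C A else ident C B)\<rparr>"
  have J: "category J"
    by unfold_locales (auto simp: J_def Hom_def)
  moreover have "finite (arr J)" by (simp add: J_def)
  moreover have "is_functor J C G"
    using o unfolding is_functor_def J_def G_def by (auto simp: ident_left[OF ident_in])
  ultimately obtain L l where lim: "is_limit J C G L l"
    using fc unfolding finitely_complete_def by blast
  have cone: "is_cone J C G M m \<longleftrightarrow> m 0 \<in> Hom C M A \<and> m 1 \<in> Hom C M B" for M m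
  proof -
    have "is_cone J C G M m \<longleftrightarrow> M \<in> obj C \<and> m 0 \<in> Hom C M A \<and> m 1 \<in> Hom C M B \<and>
      ident C A \<cdot> m 0 = m 0 \<and> ident C B \<cdot> m 1 = m 1"
      unfolding is_cone_def J_def G_def by auto
    then show ?thesis
      using ident_left[of "m 0" M A] ident_left[of "m 1" M B] Hom_obj[of "m 0" M A] by blast
  qed
  have c: "l 0 \<in> Hom C L A" "l 1 \<in> Hom C L B"
    using lim unfolding is_limit_def cone by auto
  have "\<exists>!h. h \<in> Hom C T L \<and> l 0 \<cdot> h = u \<and> l 1 \<cdot> h = v"
    if "u \<in> Hom C T A" "v \<in> Hom C T B" for T u v
  proof -
    have "is_cone J C G T (\<lambda>n. if n = 0 then u else v)"
      unfolding cone using that by simp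
    then have ex: "\<exists>!h. h \<in> Hom C T L \<and> (\<forall>j\<in>obj J. l j \<cdot> h = (if j = 0 then u else v))"
      using lim unfolding is_limit_def by blast
    have iff: "(\<forall>j\<in>obj J. l j \<cdot> h = (if j = 0 then u else v)) \<longleftrightarrow> l 0 \<cdot> h = u \<and> l 1 \<cdot> h = v" for h
      by (simp add: J_def)
    show ?thesis using ex unfolding iff .
  qed
  then have "is_product C A B L (l 0) (l 1)"
    unfolding is_product_def using o c Hom_obj[OF c(1)] by auto
  then show ?thesis using that by blast
qed


lemma product_lift:
  assumes "is_product C A B P p q" "u \<in> Hom C T A" "v \<in> Hom C T B"
  shows "\<exists>!h. h \<in> Hom C T P \<and> p \<cdot> h = u \<and> q \<cdot> h = v"
proof -
  have "\<forall>T\<in>obj C. \<forall>u\<in>Hom C T A. \<forall>v\<in>Hom C T B. \<exists>!h. h \<in> Hom C T P \<and> p \<cdot> h = u \<and> q \<cdot> h = v"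
    using assms(1) unfolding is_product_def by (elim conjE)
  moreover have "T \<in> obj C" using Hom_obj[OF assms(2)] by simp
  ultimately show ?thesis using assms(2,3) by (elim ballE) auto
qed

text \<open>Since \<open>q\<close> is invertible, \<open>q' \<cdot> v\<close> is the only possible
  mediating arrow; its \<open>p\<close>-component is \<open>u\<close> because both agree after
  \<open>a\<close>, which the left inverse \<open>a'\<close> cancels.\<close>

lemma pullback_of_isos:
  assumes a: "a \<in> Hom C A D" and b: "b \<in> Hom C B D" and p: "p \<in> Hom C P A" and q: "q \<in> Hom C P B"
    and sq: "a \<cdot> p = b \<cdot> q"
    and a': "a' \<in> Hom C D A" "a' \<cdot> a = ident C A"
    and q': "q' \<in> Hom C B P" "q' \<cdot> q = ident C P" "q \<cdot> q' = ident C B"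
  shows "is_pullback C a b p q"
proof (rule pullbackI[OF a b p q sq])
  fix T u v assume u: "u \<in> Hom C T A" and v: "v \<in> Hom C T B" and uv: "a \<cdot> u = b \<cdot> v"
  have h: "q' \<cdot> v \<in> Hom C T P" using q' v by auto
  have qh: "q \<cdot> (q' \<cdot> v) = v" using assoc[OF v q'(1) q] q'(3) ident_left[OF v] by simp
  have "a \<cdot> (p \<cdot> (q' \<cdot> v)) = a \<cdot> u"
    using assoc[OF h p a] assoc[OF h q b] sq qh uv by simp
  moreover have "a' \<cdot> (a \<cdot> w) = w" if "w \<in> Hom C T A" for w
    using assoc[OF that a a'(1)] a'(2) ident_left[OF that] by simp
  ultimately have "p \<cdot> (q' \<cdot> v) = u"
    using comp_in[OF h p] u by metis
  with h qh show "\<exists>h\<in>Hom C T P. p \<cdot> h = u \<and> q \<cdot> h = v" by blast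
next
  fix T h k assume hk: "h \<in> Hom C T P" "k \<in> Hom C T P" "q \<cdot> h = q \<cdot> k"
  show "h = k"
    using assoc[OF hk(1) q q'(1)] assoc[OF hk(2) q q'(1)] hk(3) q'(2)
      ident_left[OF hk(1)] ident_left[OF hk(2)] by simp
qed

section \<open>Reflective full subcategories\<close>

lemma full_subcategory_simps:
  "Hom (full_subcategory C S) A B = {f \<in> Hom C A B. A \<in> S \<and> B \<in> S}"
  "obj (full_subcategory C S) = obj C \<inter> S"
  "ident (full_subcategory C S) = ident C"
  "comp (full_subcategory C S) = comp C"
  "Dom (full_subcategory C S) = Dom C"
  "Cod (full_subcategory C S) = Cod C"
  by (auto simp: full_subcategory_def Hom_def)

lemma category_full_subcategory: "category (full_subcategory C S)"
proof (unfold_locales, goal_cases)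
  case (4 f A B g D)
  then show ?case by (auto simp: full_subcategory_simps)
next
  case (5 f A B)
  then show ?case by (auto simp: full_subcategory_simps ident_left)
next
  case (6 f A B)
  then show ?case by (auto simp: full_subcategory_simps ident_right)
next
  case (7 f A B g D h E)
  then show ?case using assoc[of f A B g D h E] by (auto simp: full_subcategory_simps)
qed (auto simp: full_subcategory_def Hom_def)

context
  fixes S F \<eta>
  assumes adj: "left_adjoint C (full_subcategory C S) F inclusion \<eta>"
begin

lemma reflector_functor:
  "\<forall>A\<in>obj C. on_obj F A \<in> obj C \<inter> S"
  "\<forall>f\<in>arr C. on_arr F f \<in> Hom C (on_obj F (Dom C f)) (on_obj F (Cod C f))"
  "\<forall>f\<in>arr C. \<forall>g\<in>arr C. Cod C f = Dom C g \<longrightarrow> on_arr F (g \<cdot> f) = on_arr F g \<cdot> on_arr F f"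
  using adj unfolding left_adjoint_def is_functor_def full_subcategory_simps by simp_all

lemma reflector_obj: "X \<in> obj C \<Longrightarrow> on_obj F X \<in> obj C \<inter> S"
  by (rule reflector_functor(1)[rule_format])

lemma unit_in: "X \<in> obj C \<Longrightarrow> \<eta> X \<in> Hom C X (on_obj F X)"
  using adj unfolding left_adjoint_def inclusion_def by simp

lemma reflector_arr:
  assumes f: "f \<in> Hom C X Y"
  shows "on_arr F f \<in> Hom C (on_obj F X) (on_obj F Y)" "on_arr F f \<cdot> \<eta> X = \<eta> Y \<cdot> f"
proof -
  have d: "f \<in> arr C" "Dom C f = X" "Cod C f = Y" using f by (auto simp: Hom_def)
  then show "on_arr F f \<in> Hom C (on_obj F X) (on_obj F Y)" using reflector_functor(2) by blast
  have "\<forall>f\<in>arr C. \<eta> (Cod C f) \<cdot> f = on_arr F f \<cdot> \<eta> (Dom C f)"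
    using adj unfolding left_adjoint_def inclusion_def by simp
  then show "on_arr F f \<cdot> \<eta> X = \<eta> Y \<cdot> f" using d by metis
qed

lemma reflector_comp:
  assumes "f \<in> Hom C X Y" "g \<in> Hom C Y Z"
  shows "on_arr F (g \<cdot> f) = on_arr F g \<cdot> on_arr F f"
  by (rule reflector_functor(3)[rule_format]) (use assms in \<open>auto simp: Hom_def\<close>)

lemma unit_universal:
  assumes "W \<in> obj C \<inter> S" "g \<in> Hom C X W"
  shows "\<exists>!k. k \<in> Hom C (on_obj F X) W \<and> k \<cdot> \<eta> X = g"
proof -
  have X: "X \<in> obj C" using Hom_obj[OF assms(2)] by simp
  have "\<forall>A\<in>obj C. \<forall>B\<in>obj C \<inter> S. \<forall>h\<in>Hom C A B.
    \<exists>!k. (k \<in> Hom C (on_obj F A) B \<and> on_obj F A \<in> S \<and> B \<in> S) \<and> k \<cdot> \<eta> A = h"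
    using adj unfolding left_adjoint_def full_subcategory_simps inclusion_def by simp
  then have "\<exists>!k. (k \<in> Hom C (on_obj F X) W \<and> on_obj F X \<in> S \<and> W \<in> S) \<and> k \<cdot> \<eta> X = g"
    using X assms by blast
  then show ?thesis using reflector_obj[OF X] assms(1) by auto
qed

lemma unit_cancel:
  assumes "W \<in> obj C \<inter> S" "X \<in> obj C" "u \<in> Hom C (on_obj F X) W" "v \<in> Hom C (on_obj F X) W"
    "u \<cdot> \<eta> X = v \<cdot> \<eta> X"
  shows "u = v"
  using unit_universal[OF assms(1) comp_in[OF unit_in[OF assms(2)] assms(3)]] assms by metis

text \<open>Two universal arrows from the same object differ by a unique isomorphism. This is the
  bridge from an abstract adjunction to a concrete model of the reflection.\<close>

lemma universal_arrow_iso_unit: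
  assumes h: "h \<in> Hom C X Q" and Q: "Q \<in> obj C \<inter> S"
    and univ: "\<And>W g. W \<in> obj C \<inter> S \<Longrightarrow> g \<in> Hom C X W \<Longrightarrow> \<exists>!k. k \<in> Hom C Q W \<and> k \<cdot> h = g"
  obtains k k' where "k \<in> Hom C Q (on_obj F X)" "k' \<in> Hom C (on_obj F X) Q" "k \<cdot> h = \<eta> X"
    "k' \<cdot> k = ident C Q" "k \<cdot> k' = ident C (on_obj F X)"
proof -
  have X: "X \<in> obj C" using Hom_obj[OF h] by simp
  note e = unit_in[OF X] and FX = reflector_obj[OF X]
  obtain k where k: "k \<in> Hom C Q (on_obj F X)" "k \<cdot> h = \<eta> X"
    using univ[OF FX e] by blast
  obtain k' where k': "k' \<in> Hom C (on_obj F X) Q" "k' \<cdot> \<eta> X = h"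
    using unit_universal[OF Q h] by blast
  have "k' \<cdot> k = ident C Q"
  proof -
    have "(k' \<cdot> k) \<cdot> h = h" "ident C Q \<cdot> h = h"
      using assoc[OF h k(1) k'(1)] k k' ident_left[OF h] by simp_all
    moreover have "k' \<cdot> k \<in> Hom C Q Q" "ident C Q \<in> Hom C Q Q" using k k' Q by auto
    ultimately show ?thesis using univ[OF Q h] by blast
  qed
  moreover have "k \<cdot> k' = ident C (on_obj F X)"
  proof (rule unit_cancel[OF FX X])
    show "(k \<cdot> k') \<cdot> \<eta> X = ident C (on_obj F X) \<cdot> \<eta> X"
      using assoc[OF e k'(1) k(1)] k k' ident_left[OF e] by simp
  qed (use k k' FX in auto)
  ultimately show ?thesis using that k k' by blast
qed

text \<open>Naturality of \<eta> at the arrow \<open>\<eta> X\<close> makes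
  \<open>F (\<eta> X)\<close> and \<open>\<eta> (F X)\<close> agree on \<open>\<eta> X\<close>, so
  they are equal. The second one has a left inverse, since the identity of \<open>F X\<close>
  extends along it.\<close>

lemma reflector_unit_iso:
  assumes X: "X \<in> obj C"
  obtains \<epsilon> where "\<epsilon> \<in> Hom C (on_obj F (on_obj F X)) (on_obj F X)"
    "\<epsilon> \<cdot> on_arr F (\<eta> X) = ident C (on_obj F X)"
proof -
  let ?Y = "on_obj F X"
  note FX = reflector_obj[OF X] and e = unit_in[OF X]
  then have Y: "?Y \<in> obj C" by simp
  note FY = reflector_obj[OF Y] and e' = unit_in[OF Y] and Fe = reflector_arr[OF e]
  have i: "ident C ?Y \<in> Hom C ?Y ?Y" using Y by simp
  obtain \<epsilon> where "\<epsilon> \<in> Hom C (on_obj F ?Y) ?Y" "\<epsilon> \<cdot> \<eta> ?Y = ident C ?Y"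
    using unit_universal[OF FX i] by blast
  moreover have "on_arr F (\<eta> X) = \<eta> ?Y"
    by (rule unit_cancel[OF FY X Fe(1) e' Fe(2)])
  ultimately show ?thesis using that by simp
qed

text \<open>The hypotheses say that objects of \<open>S\<close> see \<open>q\<close> as an
  isomorphism. The inverse \<open>r\<close> comes from extending \<open>\<eta> P\<close> first along
  \<open>q\<close> to \<open>k\<close>, then along \<open>\<eta> Z\<close>; both equations are
  checked after composing with units, where they reduce to
  \<open>k \<cdot> q = \<eta> P\<close>.\<close>

lemma reflector_iso:
  assumes q: "q \<in> Hom C P Z"
    and epi: "\<And>W u v. W \<in> S \<Longrightarrow> u \<in> Hom C Z W \<Longrightarrow> v \<in> Hom C Z W \<Longrightarrow> u \<cdot> q = v \<cdot> q \<Longrightarrow> u = v"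
    and ext: "\<And>W g. W \<in> S \<Longrightarrow> g \<in> Hom C P W \<Longrightarrow> \<exists>k\<in>Hom C Z W. k \<cdot> q = g"
  obtains r where "r \<in> Hom C (on_obj F Z) (on_obj F P)"
    "r \<cdot> on_arr F q = ident C (on_obj F P)" "on_arr F q \<cdot> r = ident C (on_obj F Z)"
proof -
  have P: "P \<in> obj C" and Z: "Z \<in> obj C" using Hom_obj[OF q] by auto
  note eP = unit_in[OF P] and eZ = unit_in[OF Z] and FP = reflector_obj[OF P] and FZ = reflector_obj[OF Z]
  note Fq = reflector_arr[OF q]
  obtain k where k: "k \<in> Hom C Z (on_obj F P)" "k \<cdot> q = \<eta> P"
    using ext[OF _ eP] FP by blast
  obtain r where r: "r \<in> Hom C (on_obj F Z) (on_obj F P)" "r \<cdot> \<eta> Z = k"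
    using unit_universal[OF FP k(1)] by blast
  have "r \<cdot> on_arr F q = ident C (on_obj F P)"
  proof (rule unit_cancel[OF FP P])
    show "(r \<cdot> on_arr F q) \<cdot> \<eta> P = ident C (on_obj F P) \<cdot> \<eta> P"
      using assoc[OF eP Fq(1) r(1)] assoc[OF q eZ r(1)] Fq(2) r(2) k(2) ident_left[OF eP] by simp
  qed (use Fq r FP in auto)
  moreover have Fk: "on_arr F q \<cdot> k = \<eta> Z"
    by (rule epi[of "on_obj F Z"])
      (use FZ comp_in[OF k(1) Fq(1)] eZ assoc[OF q k(1) Fq(1)] k(2) Fq(2) in auto)
  have "on_arr F q \<cdot> r = ident C (on_obj F Z)"
  proof (rule unit_cancel[OF FZ Z comp_in[OF r(1) Fq(1)]])
    show "ident C (on_obj F Z) \<in> Hom C (on_obj F Z) (on_obj F Z)" using FZ by simp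
    show "(on_arr F q \<cdot> r) \<cdot> \<eta> Z = ident C (on_obj F Z) \<cdot> \<eta> Z"
      using assoc[OF eZ r(1) Fq(1)] ident_left[OF eZ] r(2) Fk by simp
  qed
  ultimately show ?thesis using that r(1) by blast
qed

text \<open>Functoriality makes the image square commute. One of its parallel sides,
  \<open>F (\<eta> X)\<close>, has a left inverse and the other, \<open>F q\<close>, is invertible,
  so \<open>pullback_of_isos\<close> applies inside the subcategory; fullness places the inverses
  there.\<close>

lemma reflector_preserves_pullback:
  assumes X: "X \<in> obj C" and f: "f \<in> Hom C Z (on_obj F X)" and pb: "is_pullback C (\<eta> X) f p q"
    and epi: "\<And>W u v. W \<in> S \<Longrightarrow> u \<in> Hom C Z W \<Longrightarrow> v \<in> Hom C Z W \<Longrightarrow> u \<cdot> q = v \<cdot> q \<Longrightarrow> u = v"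
    and ext: "\<And>W g. W \<in> S \<Longrightarrow> g \<in> Hom C (Dom C p) W \<Longrightarrow> \<exists>k\<in>Hom C Z W. k \<cdot> q = g"
  shows "is_pullback (full_subcategory C S) (on_arr F (\<eta> X)) (on_arr F f) (on_arr F p) (on_arr F q)"
proof -
  let ?P = "Dom C p"
  note e = unit_in[OF X]
  have pq: "p \<in> Hom C ?P X" "q \<in> Hom C ?P Z" "\<eta> X \<cdot> p = f \<cdot> q"
    using pullback_typing[OF pb] e f by (auto simp: Hom_def)
  have o: "?P \<in> obj C" "Z \<in> obj C" "on_obj F X \<in> obj C" using pq(2) reflector_obj[OF X] Hom_obj by auto
  obtain \<epsilon> where \<epsilon>: "\<epsilon> \<in> Hom C (on_obj F (on_obj F X)) (on_obj F X)"
    "\<epsilon> \<cdot> on_arr F (\<eta> X) = ident C (on_obj F X)" by (rule reflector_unit_iso[OF X])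
  obtain r where r: "r \<in> Hom C (on_obj F Z) (on_obj F ?P)"
    "r \<cdot> on_arr F q = ident C (on_obj F ?P)" "on_arr F q \<cdot> r = ident C (on_obj F Z)"
    by (rule reflector_iso[OF pq(2) epi ext])
  show ?thesis
  proof (rule category.pullback_of_isos[OF category_full_subcategory, unfolded full_subcategory_simps])
    show "on_arr F (\<eta> X) \<cdot> on_arr F p = on_arr F f \<cdot> on_arr F q"
      using reflector_comp[OF pq(1) e] reflector_comp[OF pq(2) f] pq(3) by simp
    show "\<epsilon> \<cdot> on_arr F (\<eta> X) = ident C (on_obj F X)" by (rule \<epsilon>(2))
    show "r \<cdot> on_arr F q = ident C (on_obj F ?P)" "on_arr F q \<cdot> r = ident C (on_obj F Z)" by (rule r)+
  qed (use reflector_arr(1)[OF e] reflector_arr(1)[OF f] reflector_arr(1)[OF pq(1)] reflector_arr(1)[OF pq(2)]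
      \<epsilon> r reflector_obj X o in auto)
qed

end

section \<open>Regular epimorphisms and generalized elements of relations\<close>

lemma regular_epi_cancel:
  assumes "is_regular_epi C e" "e \<in> Hom C A B" "x \<in> Hom C B D" "y \<in> Hom C B D" "x \<cdot> e = y \<cdot> e"
  shows "x = y"
proof -
  obtain u v where c: "is_coequalizer C u v e" using assms(1) unfolding is_regular_epi_def by blast
  then have t: "u \<in> Hom C (Dom C u) A" "v \<in> Hom C (Dom C u) A" "e \<cdot> u = e \<cdot> v" "Cod C u = A" "Cod C e = B"
    using assms(2) unfolding is_coequalizer_def by (auto simp: Hom_def)
  have "(x \<cdot> e) \<cdot> u = (x \<cdot> e) \<cdot> v"
    using assoc[OF t(1) assms(2,3)] assoc[OF t(2) assms(2,3)] t(3) by simp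
  moreover have "x \<cdot> e \<in> Hom C A D" using assms by auto
  moreover have "D \<in> obj C" using assms(3) Hom_obj by blast
  ultimately have "\<exists>!k. k \<in> Hom C B D \<and> k \<cdot> e = x \<cdot> e"
    using c t unfolding is_coequalizer_def by metis
  then show ?thesis using assms by metis
qed

text \<open>The pair coequalized by \<open>e\<close> is one of the pairs that \<open>e\<close>
  identifies. Quantifying over all of them keeps that pair out of later arguments, which can then
  reason about arbitrary elements.\<close>

lemma regular_epi_factor:
  assumes "is_regular_epi C e" "e \<in> Hom C A B" "g \<in> Hom C A D"
    and "\<And>T s t. s \<in> Hom C T A \<Longrightarrow> t \<in> Hom C T A \<Longrightarrow> e \<cdot> s = e \<cdot> t \<Longrightarrow> g \<cdot> s = g \<cdot> t"
  obtains k where "k \<in> Hom C B D" "k \<cdot> e = g"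
proof -
  obtain u v where c: "is_coequalizer C u v e" using assms(1) unfolding is_regular_epi_def by blast
  then have t: "u \<in> Hom C (Dom C u) A" "v \<in> Hom C (Dom C u) A" "e \<cdot> u = e \<cdot> v" "Cod C u = A" "Cod C e = B"
    using assms(2) unfolding is_coequalizer_def by (auto simp: Hom_def)
  have "g \<cdot> u = g \<cdot> v" by (rule assms(4)[OF t(1-3)])
  moreover have "D \<in> obj C" using assms(3) Hom_obj by blast
  ultimately have "\<exists>!k. k \<in> Hom C B D \<and> k \<cdot> e = g"
    using c t assms(3) unfolding is_coequalizer_def by metis
  then show ?thesis using that by blast
qed

lemma mono_cancel:
  assumes "is_mono C m" "m \<in> Hom C A B" "x \<in> Hom C T A" "y \<in> Hom C T A" "m \<cdot> x = m \<cdot> y"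
  shows "x = y"
proof -
  have "T \<in> obj C" "Dom C m = A" using assms(2,3) by (auto simp: Hom_def)
  then show ?thesis using assms unfolding is_mono_def by blast
qed

end

text \<open>Membership of generalized elements, as in Kripke--Joyal semantics; for regular epimorphisms it
  can be checked locally, so that proofs about elements carry over from sets to exact categories.\<close>
definition related :: "('o, 'a) cat \<Rightarrow> ('o, 'a) irel \<Rightarrow> 'o \<Rightarrow> 'a \<Rightarrow> 'a \<Rightarrow> bool" where
  "related C \<rho> T x y \<longleftrightarrow>
     (\<exists>a\<in>Hom C T (graph C \<rho>). fst_proj \<rho> \<cdot>\<^bsub>C\<^esub> a = x \<and> snd_proj \<rho> \<cdot>\<^bsub>C\<^esub> a = y)"

section \<open>Relations and preorders through generalized elements\<close>

context category
begin

lemma related_opposite: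
  assumes "is_relation C \<rho>"
  shows "related C (opposite \<rho>) T x y \<longleftrightarrow> related C \<rho> T y x"
proof -
  have "graph C (opposite \<rho>) = graph C \<rho>"
    using assms unfolding is_relation_def by (auto simp: graph_def opposite_def Hom_def)
  then show ?thesis by (auto simp: related_def opposite_def)
qed

lemma related_diagonal:
  assumes "x \<in> Hom C T A"
  shows "related C (diagonal C A) T x y \<longleftrightarrow> x = y"
  using assms Hom_obj[OF assms]
  by (auto simp: related_def diagonal_def graph_def ident_left)

lemma relation_typing:
  assumes "is_relation C \<rho>"
  shows "fst_proj \<rho> \<in> Hom C (graph C \<rho>) (carrier \<rho>)" "snd_proj \<rho> \<in> Hom C (graph C \<rho>) (carrier \<rho>)"
    "carrier \<rho> \<in> obj C" "graph C \<rho> \<in> obj C"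
  using assms Hom_obj unfolding is_relation_def by blast+

text \<open>Equal components give equal arrows into the product, and the monomorphism is then
  cancelled. In this form, as joint monicity, being a relation is used from here on.\<close>

lemma relation_eqI:
  assumes "is_relation C \<rho>" "a \<in> Hom C T (graph C \<rho>)" "b \<in> Hom C T (graph C \<rho>)"
    "fst_proj \<rho> \<cdot> a = fst_proj \<rho> \<cdot> b" "snd_proj \<rho> \<cdot> a = snd_proj \<rho> \<cdot> b"
  shows "a = b"
proof -
  obtain P p q m where P: "is_product C (carrier \<rho>) (carrier \<rho>) P p q"
    and m: "m \<in> Hom C (graph C \<rho>) P" "p \<cdot> m = fst_proj \<rho>" "q \<cdot> m = snd_proj \<rho>" "is_mono C m"
    using assms(1) unfolding is_relation_def by blast
  have pq: "p \<in> Hom C P (carrier \<rho>)" "q \<in> Hom C P (carrier \<rho>)" using P unfolding is_product_def by auto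
  have ma: "m \<cdot> a \<in> Hom C T P" "m \<cdot> b \<in> Hom C T P" using assms m by auto
  have "\<exists>!h. h \<in> Hom C T P \<and> p \<cdot> h = p \<cdot> (m \<cdot> a) \<and> q \<cdot> h = q \<cdot> (m \<cdot> a)"
    by (rule product_lift[OF P comp_in[OF ma(1) pq(1)] comp_in[OF ma(1) pq(2)]])
  moreover have "p \<cdot> (m \<cdot> b) = p \<cdot> (m \<cdot> a)" "q \<cdot> (m \<cdot> b) = q \<cdot> (m \<cdot> a)"
    using assoc[OF assms(2) m(1) pq(1)] assoc[OF assms(2) m(1) pq(2)]
      assoc[OF assms(3) m(1) pq(1)] assoc[OF assms(3) m(1) pq(2)] m assms by simp_all
  ultimately have "m \<cdot> a = m \<cdot> b" using ma by metis
  then show ?thesis using mono_cancel[OF m(4,1) assms(2,3)] by simp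
qed

text \<open>Finite completeness supplies a product; the pairing of \<open>r1\<close> and
  \<open>r2\<close> into it is monic because they are jointly monic.\<close>

lemma relationI:
  assumes "finitely_complete C" "r1 \<in> Hom C R A" "r2 \<in> Hom C R A"
    and "\<And>T a b. a \<in> Hom C T R \<Longrightarrow> b \<in> Hom C T R \<Longrightarrow> r1 \<cdot> a = r1 \<cdot> b \<Longrightarrow> r2 \<cdot> a = r2 \<cdot> b \<Longrightarrow> a = b"
  shows "is_relation C (IRel A r1 r2)"
proof -
  have A: "A \<in> obj C" "R \<in> obj C" "Dom C r1 = R" using assms(2) by (auto simp: Hom_def)
  then obtain P p q where P: "is_product C A A P p q" using ex_product[OF assms(1)] by blast
  then obtain m where m: "m \<in> Hom C R P" "p \<cdot> m = r1" "q \<cdot> m = r2"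
    using product_lift[OF _ assms(2,3)] by blast
  have pq: "p \<in> Hom C P A" "q \<in> Hom C P A" using P unfolding is_product_def by auto
  have "is_mono C m"
    unfolding is_mono_def
  proof (intro conjI ballI impI)
    show "m \<in> arr C" using m by (auto simp: Hom_def)
    fix T u v assume "u \<in> Hom C T (Dom C m)" "v \<in> Hom C T (Dom C m)" and e: "m \<cdot> u = m \<cdot> v"
    moreover have "Dom C m = R" using m by (auto simp: Hom_def)
    ultimately have uv: "u \<in> Hom C T R" "v \<in> Hom C T R" by auto
    show "u = v"
      using assms(4)[OF uv] e m assoc[OF uv(1) m(1) pq(1)] assoc[OF uv(2) m(1) pq(1)]
        assoc[OF uv(1) m(1) pq(2)] assoc[OF uv(2) m(1) pq(2)] by simp
  qed
  then show ?thesis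
    using P m assms(2,3) A unfolding is_relation_def graph_def by auto
qed

lemma related_typing:
  assumes "is_relation C \<rho>" "related C \<rho> T x y"
  shows "x \<in> Hom C T (carrier \<rho>)" "y \<in> Hom C T (carrier \<rho>)"
  using assms relation_typing[OF assms(1)] unfolding related_def by auto

lemma related_comp:
  assumes "is_relation C \<rho>" "related C \<rho> T x y" "t \<in> Hom C T' T"
  shows "related C \<rho> T' (x \<cdot> t) (y \<cdot> t)"
proof -
  obtain a where a: "a \<in> Hom C T (graph C \<rho>)" "fst_proj \<rho> \<cdot> a = x" "snd_proj \<rho> \<cdot> a = y"
    using assms(2) unfolding related_def by blast
  show ?thesis unfolding related_def
    using assoc[OF assms(3) a(1)] relation_typing[OF assms(1)] a assms(3)
    by (intro bexI[of _ "a \<cdot> t"]) auto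
qed

text \<open>A witness over the cover is determined by its two components, and these come from
  \<open>T\<close>; so it takes equal values on elements identified by \<open>c\<close> and factors
  through \<open>c\<close>. The components of the factor are right because \<open>c\<close> is
  epic.\<close>

lemma related_descent:
  assumes "is_relation C \<rho>" "is_regular_epi C c" "c \<in> Hom C T' T"
    "x \<in> Hom C T (carrier \<rho>)" "y \<in> Hom C T (carrier \<rho>)" "related C \<rho> T' (x \<cdot> c) (y \<cdot> c)"
  shows "related C \<rho> T x y"
proof -
  note r = relation_typing[OF assms(1)]
  obtain a where a: "a \<in> Hom C T' (graph C \<rho>)" "fst_proj \<rho> \<cdot> a = x \<cdot> c" "snd_proj \<rho> \<cdot> a = y \<cdot> c"
    using assms(6) unfolding related_def by blast
  obtain k where k: "k \<in> Hom C T (graph C \<rho>)" "k \<cdot> c = a"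
  proof (rule regular_epi_factor[OF assms(2,3) a(1)])
    fix S s t assume st: "s \<in> Hom C S T'" "t \<in> Hom C S T'" "c \<cdot> s = c \<cdot> t"
    show "a \<cdot> s = a \<cdot> t"
    proof (rule relation_eqI[OF assms(1)])
      show "a \<cdot> s \<in> Hom C S (graph C \<rho>)" "a \<cdot> t \<in> Hom C S (graph C \<rho>)" using st a by auto
      show "fst_proj \<rho> \<cdot> (a \<cdot> s) = fst_proj \<rho> \<cdot> (a \<cdot> t)"
        using assoc[OF st(1) a(1) r(1)] assoc[OF st(2) a(1) r(1)] a
          assoc[OF st(1) assms(3,4)] assoc[OF st(2) assms(3,4)] st(3) by simp
      show "snd_proj \<rho> \<cdot> (a \<cdot> s) = snd_proj \<rho> \<cdot> (a \<cdot> t)"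
        using assoc[OF st(1) a(1) r(2)] assoc[OF st(2) a(1) r(2)] a
          assoc[OF st(1) assms(3,5)] assoc[OF st(2) assms(3,5)] st(3) by simp
    qed
  qed
  have "fst_proj \<rho> \<cdot> k = x"
    by (rule regular_epi_cancel[OF assms(2,3) _ assms(4)])
      (use k r a assoc[OF assms(3) k(1) r(1)] in auto)
  moreover have "snd_proj \<rho> \<cdot> k = y"
    by (rule regular_epi_cancel[OF assms(2,3) _ assms(5)])
      (use k r a assoc[OF assms(3) k(1) r(2)] in auto)
  ultimately show ?thesis using k unfolding related_def by blast
qed

lemma rel_le_iff_related:
  assumes "is_relation C \<kappa>"
  shows "rel_le C \<kappa> \<rho> \<longleftrightarrow> carrier \<kappa> = carrier \<rho> \<and> related C \<rho> (graph C \<kappa>) (fst_proj \<kappa>) (snd_proj \<kappa>)"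
  by (auto simp: rel_le_def related_def)

lemma rel_le_related:
  assumes "is_relation C \<kappa>" "is_relation C \<rho>" "rel_le C \<kappa> \<rho>" "related C \<kappa> T x y"
  shows "related C \<rho> T x y"
proof -
  obtain a where a: "a \<in> Hom C T (graph C \<kappa>)" "fst_proj \<kappa> \<cdot> a = x" "snd_proj \<kappa> \<cdot> a = y"
    using assms(4) unfolding related_def by blast
  have "related C \<rho> (graph C \<kappa>) (fst_proj \<kappa>) (snd_proj \<kappa>)"
    using assms(3) rel_le_iff_related[OF assms(1)] by blast
  from related_comp[OF assms(2) this a(1)] a show ?thesis by simp
qed

text \<open>The identity of the graph witnesses the generic related pair, of which every other one
  is a restriction. Claims about all related pairs need testing only here, which is how
  \<open>rel_leI\<close> and \<open>mor_exists\<close> produce actual arrows.\<close>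

lemma related_universal:
  assumes "is_relation C \<kappa>"
  shows "related C \<kappa> (graph C \<kappa>) (fst_proj \<kappa>) (snd_proj \<kappa>)"
  unfolding related_def using relation_typing[OF assms] ident_right
  by (intro bexI[of _ "ident C (graph C \<kappa>)"]) auto

lemma rel_leI:
  assumes "is_relation C \<kappa>" "carrier \<kappa> = carrier \<rho>"
    and "\<And>T x y. related C \<kappa> T x y \<Longrightarrow> related C \<rho> T x y"
  shows "rel_le C \<kappa> \<rho>"
  using assms(2) assms(3)[OF related_universal[OF assms(1)]] rel_le_iff_related[OF assms(1)] by blast

lemma diagonal_relation:
  assumes "finitely_complete C" "A \<in> obj C"
  shows "is_relation C (diagonal C A)"
  unfolding diagonal_def
  by (rule relationI[OF assms(1)]) (use assms(2) ident_left in auto)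

lemma opposite_relation:
  assumes "finitely_complete C" "is_relation C \<rho>"
  shows "is_relation C (opposite \<rho>)"
  unfolding opposite_def
  by (rule relationI[OF assms(1) relation_typing(2,1)[OF assms(2)]])
    (rule relation_eqI[OF assms(2)])

lemma reflexive_related:
  assumes "is_relation C \<rho>" "is_reflexive C \<rho>" "x \<in> Hom C T (carrier \<rho>)"
  shows "related C \<rho> T x x"
proof -
  have i: "ident C (carrier \<rho>) \<in> Hom C (carrier \<rho>) (carrier \<rho>)" using Hom_obj[OF assms(3)] by auto
  have "related C \<rho> (carrier \<rho>) (ident C (carrier \<rho>)) (ident C (carrier \<rho>))"
    using assms(2) Hom_obj[OF assms(3)]
    by (auto simp: is_reflexive_def rel_le_def related_def diagonal_def graph_def)
  from related_comp[OF assms(1) this assms(3)] show ?thesis using ident_left[OF assms(3)] by simp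
qed

lemma transitive_related:
  assumes "is_relation C \<rho>" "is_transitive C \<rho>" "related C \<rho> T x y" "related C \<rho> T y z"
  shows "related C \<rho> T x z"
proof -
  note r = relation_typing[OF assms(1)]
  obtain a where a: "a \<in> Hom C T (graph C \<rho>)" "fst_proj \<rho> \<cdot> a = x" "snd_proj \<rho> \<cdot> a = y"
    using assms(3) unfolding related_def by blast
  obtain b where b: "b \<in> Hom C T (graph C \<rho>)" "fst_proj \<rho> \<cdot> b = y" "snd_proj \<rho> \<cdot> b = z"
    using assms(4) unfolding related_def by blast
  obtain p1 p2 t where p: "is_pullback C (snd_proj \<rho>) (fst_proj \<rho>) p1 p2"
    and t: "t \<in> Hom C (Dom C p1) (graph C \<rho>)" "fst_proj \<rho> \<cdot> t = fst_proj \<rho> \<cdot> p1"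
      "snd_proj \<rho> \<cdot> t = snd_proj \<rho> \<cdot> p2"
    using assms(2) unfolding is_transitive_def by blast
  have d: "Dom C (snd_proj \<rho>) = graph C \<rho>" "Dom C (fst_proj \<rho>) = graph C \<rho>" using r by (auto simp: Hom_def)
  note pt = pullback_typing[OF p, unfolded d]
  obtain h where h: "h \<in> Hom C T (Dom C p1)" "p1 \<cdot> h = a" "p2 \<cdot> h = b"
    using pullback_lift[OF p, unfolded d, of a T b] a b by auto
  have "fst_proj \<rho> \<cdot> (t \<cdot> h) = x"
    using assoc[OF h(1) t(1) r(1)] assoc[OF h(1) pt(1) r(1)] t h a by simp
  moreover have "snd_proj \<rho> \<cdot> (t \<cdot> h) = z"
    using assoc[OF h(1) t(1) r(2)] assoc[OF h(1) pt(2) r(2)] t h b by simp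
  ultimately show ?thesis unfolding related_def using comp_in[OF h(1) t(1)] by blast
qed

lemma reflexiveI:
  assumes "carrier \<rho> \<in> obj C"
    and "\<And>T x. x \<in> Hom C T (carrier \<rho>) \<Longrightarrow> related C \<rho> T x x"
  shows "is_reflexive C \<rho>"
  using assms(2)[OF ident_in[OF assms(1)]] assms(1)
  by (auto simp: is_reflexive_def rel_le_def related_def diagonal_def graph_def)

text \<open>The pullback of the two projections carries the generic chain of three elements. The
  hypothesis applied to that chain yields the required arrow from the pullback to the graph.\<close>

lemma transitiveI:
  assumes "finitely_complete C" "is_relation C \<rho>"
    and "\<And>T x y z. related C \<rho> T x y \<Longrightarrow> related C \<rho> T y z \<Longrightarrow> related C \<rho> T x z"
  shows "is_transitive C \<rho>"
proof -
  note r = relation_typing[OF assms(2)]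
  obtain p1 p2 where p: "is_pullback C (snd_proj \<rho>) (fst_proj \<rho>) p1 p2"
    using ex_pullback[OF assms(1) r(2,1)] by blast
  have d: "Dom C (snd_proj \<rho>) = graph C \<rho>" "Dom C (fst_proj \<rho>) = graph C \<rho>" using r by (auto simp: Hom_def)
  note pt = pullback_typing[OF p, unfolded d]
  have "related C \<rho> (Dom C p1) (fst_proj \<rho> \<cdot> p1) (snd_proj \<rho> \<cdot> p1)"
    "related C \<rho> (Dom C p1) (fst_proj \<rho> \<cdot> p2) (snd_proj \<rho> \<cdot> p2)"
    using pt unfolding related_def by blast+
  then have "related C \<rho> (Dom C p1) (fst_proj \<rho> \<cdot> p1) (snd_proj \<rho> \<cdot> p2)"
    using assms(3) pt(3) by metis
  then show ?thesis using p unfolding is_transitive_def related_def by blast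
qed

end

section \<open>Local preimages, the relation ~ and antisymmetry in an exact category\<close>

context exact_category
begin

text \<open>Pull \<open>e\<close> back along \<open>b\<close>: one projection is the cover, by
  stability, and the other is the preimage.\<close>

lemma regular_epi_lift:
  assumes "is_regular_epi C e" "e \<in> Hom C A B" "b \<in> Hom C T B"
  obtains T' c x where "is_regular_epi C c" "c \<in> Hom C T' T" "x \<in> Hom C T' A" "e \<cdot> x = b \<cdot> c"
proof -
  obtain p q where pb: "is_pullback C e b p q"
    using ex_pullback[OF finitely_complete assms(2,3)] by blast
  have d: "Dom C e = A" "Dom C b = T" using assms by (auto simp: Hom_def)
  show ?thesis
    using that[OF regular_epi_stable[OF pb assms(1)]] pullback_typing[OF pb, unfolded d] by blast
qed

text \<open>The meet is the intersection of two subobjects of the square of the carrier, computed as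
  the pullback of \<open>m\<close>, the pairing of the projections, and \<open>n\<close>, the same
  pairing with the components exchanged. The elementwise description is recorded too, since the
  order of subobjects alone is awkward to use.\<close>

lemma sim_exists:
  assumes r: "is_relation C \<rho>"
  obtains \<theta> where "is_sim C \<rho> \<theta>"
    "\<And>T x y. related C \<theta> T x y \<longleftrightarrow> related C \<rho> T x y \<and> related C \<rho> T y x"
proof -
  note rt = relation_typing[OF r]
  let ?r1 = "fst_proj \<rho>" and ?r2 = "snd_proj \<rho>" and ?G = "graph C \<rho>" and ?A = "carrier \<rho>"
  obtain P p q where P: "is_product C ?A ?A P p q"
    using ex_product[OF finitely_complete rt(3) rt(3)] by blast
  have pq: "p \<in> Hom C P ?A" "q \<in> Hom C P ?A" using P unfolding is_product_def by auto
  obtain m where m: "m \<in> Hom C ?G P" "p \<cdot> m = ?r1" "q \<cdot> m = ?r2"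
    using product_lift[OF P rt(1,2)] by blast
  obtain n where n: "n \<in> Hom C ?G P" "p \<cdot> n = ?r2" "q \<cdot> n = ?r1"
    using product_lift[OF P rt(2,1)] by blast
  obtain u v where pb: "is_pullback C m n u v"
    using ex_pullback[OF finitely_complete m(1) n(1)] by blast
  have d: "Dom C m = ?G" "Dom C n = ?G" using m n by (auto simp: Hom_def)
  note uv = pullback_typing[OF pb, unfolded d]
  let ?T = "Dom C u"
  define \<theta> where "\<theta> = IRel ?A (?r1 \<cdot> u) (?r2 \<cdot> u)"
  have e: "p \<cdot> (m \<cdot> a) = ?r1 \<cdot> a" "q \<cdot> (m \<cdot> a) = ?r2 \<cdot> a"
    "p \<cdot> (n \<cdot> a) = ?r2 \<cdot> a" "q \<cdot> (n \<cdot> a) = ?r1 \<cdot> a" if "a \<in> Hom C T ?G" for a T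
    using assoc[OF that m(1) pq(1)] assoc[OF that m(1) pq(2)]
      assoc[OF that n(1) pq(1)] assoc[OF that n(1) pq(2)] m n by simp_all
  have g: "graph C \<theta> = ?T" "carrier \<theta> = ?A" "fst_proj \<theta> = ?r1 \<cdot> u" "snd_proj \<theta> = ?r2 \<cdot> u"
    using comp_in[OF uv(1) rt(1)] by (auto simp: \<theta>_def graph_def Hom_def)
  \<comment> \<open>Comparing components in \<open>m \<cdot> u = n \<cdot> v\<close>: the witness
    \<open>v\<close> is for the reversed pair of \<open>u\<close>.\<close>
  have uvr: "?r1 \<cdot> u = ?r2 \<cdot> v" "?r2 \<cdot> u = ?r1 \<cdot> v"
    using e(1,2)[OF uv(1)] e(3,4)[OF uv(2)] uv(3) by simp_all
  have rel: "is_relation C \<theta>"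
    unfolding \<theta>_def
  proof (rule relationI[OF finitely_complete])
    show "?r1 \<cdot> u \<in> Hom C ?T ?A" "?r2 \<cdot> u \<in> Hom C ?T ?A" using uv rt by auto
    fix T a b assume ab: "a \<in> Hom C T ?T" "b \<in> Hom C T ?T"
      and eq: "(?r1 \<cdot> u) \<cdot> a = (?r1 \<cdot> u) \<cdot> b" "(?r2 \<cdot> u) \<cdot> a = (?r2 \<cdot> u) \<cdot> b"
    show "a = b"
    proof (rule pullback_unique[OF pb ab])
      show "u \<cdot> a = u \<cdot> b"
        by (rule relation_eqI[OF r])
          (use comp_in[OF ab(1) uv(1)] comp_in[OF ab(2) uv(1)] eq assoc[OF ab(1) uv(1)] assoc[OF ab(2) uv(1)] rt in auto)
      show "v \<cdot> a = v \<cdot> b"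
        by (rule relation_eqI[OF r])
          (use comp_in[OF ab(1) uv(2)] comp_in[OF ab(2) uv(2)] eq[unfolded uvr] assoc[OF ab(1) uv(2)] assoc[OF ab(2) uv(2)] rt in auto)
    qed
  qed
  have el: "related C \<theta> T x y \<longleftrightarrow> related C \<rho> T x y \<and> related C \<rho> T y x" for T x y
  proof
    assume "related C \<theta> T x y"
    then obtain a where a: "a \<in> Hom C T ?T" "(?r1 \<cdot> u) \<cdot> a = x" "(?r2 \<cdot> u) \<cdot> a = y"
      unfolding related_def g by blast
    have "?r1 \<cdot> (u \<cdot> a) = x" "?r2 \<cdot> (u \<cdot> a) = y" "?r1 \<cdot> (v \<cdot> a) = y" "?r2 \<cdot> (v \<cdot> a) = x"
      using assoc[OF a(1) uv(1) rt(1)] assoc[OF a(1) uv(1) rt(2)]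
        assoc[OF a(1) uv(2) rt(1)] assoc[OF a(1) uv(2) rt(2)] a uvr by simp_all
    then show "related C \<rho> T x y \<and> related C \<rho> T y x"
      unfolding related_def using comp_in[OF a(1) uv(1)] comp_in[OF a(1) uv(2)] by blast
  next
    assume "related C \<rho> T x y \<and> related C \<rho> T y x"
    then obtain a b where a: "a \<in> Hom C T ?G" "?r1 \<cdot> a = x" "?r2 \<cdot> a = y"
      and b: "b \<in> Hom C T ?G" "?r1 \<cdot> b = y" "?r2 \<cdot> b = x"
      unfolding related_def by blast
    have ma: "m \<cdot> a \<in> Hom C T P" "n \<cdot> b \<in> Hom C T P" using m n a b by auto
    have "m \<cdot> a = n \<cdot> b"
      using product_lift[OF P comp_in[OF a(1) rt(1)] comp_in[OF a(1) rt(2)]] ma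
        e(1,2)[OF a(1)] e(3,4)[OF b(1)] a b by metis
    then obtain h where h: "h \<in> Hom C T ?T" "u \<cdot> h = a"
      using pullback_lift[OF pb, unfolded d, OF a(1) b(1)] by blast
    then have "(?r1 \<cdot> u) \<cdot> h = x" "(?r2 \<cdot> u) \<cdot> h = y"
      using assoc[OF h(1) uv(1) rt(1)] assoc[OF h(1) uv(1) rt(2)] a by simp_all
    then show "related C \<theta> T x y" unfolding related_def g using h by blast
  qed
  have "is_sim C \<rho> \<theta>"
    unfolding is_sim_def is_meet_def
  proof (intro conjI allI impI)
    have c: "carrier (opposite \<rho>) = ?A" by (simp add: opposite_def)
    show "is_relation C \<theta>" by fact
    show "rel_le C \<theta> \<rho>" by (rule rel_leI[OF rel g(2)]) (simp add: el)
    show "rel_le C \<theta> (opposite \<rho>)" by (rule rel_leI[OF rel]) (simp_all add: el g c related_opposite[OF r])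
    fix \<kappa> assume k: "is_relation C \<kappa> \<and> rel_le C \<kappa> \<rho> \<and> rel_le C \<kappa> (opposite \<rho>)"
    show "rel_le C \<kappa> \<theta>"
    proof (rule rel_leI)
      show "is_relation C \<kappa>" "carrier \<kappa> = carrier \<theta>" using k g by (auto simp: rel_le_def)
      show "related C \<theta> T x y" if "related C \<kappa> T x y" for T x y
        using that k el related_opposite[OF r] rel_le_related[OF _ r, of \<kappa> T x y]
          rel_le_related[OF _ opposite_relation[OF finitely_complete r], of \<kappa> T x y] by blast
    qed
  qed
  then show ?thesis using that el by blast
qed

lemma ex_sim: "is_relation C \<rho> \<Longrightarrow> \<exists>\<theta>. is_sim C \<rho> \<theta>"
  by (erule sim_exists) (rule exI)

text \<open>Meets are unique up to mutual containment, and containment transports elements; so an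
  arbitrary \<theta> has the same elements as the one constructed in
  \<open>sim_exists\<close>.\<close>

lemma sim_related:
  assumes r: "is_relation C \<rho>" and s: "is_sim C \<rho> \<theta>"
  shows "is_relation C \<theta>" "carrier \<theta> = carrier \<rho>"
    "related C \<theta> T x y \<longleftrightarrow> related C \<rho> T x y \<and> related C \<rho> T y x"
proof -
  obtain \<theta>' where t: "is_sim C \<rho> \<theta>'"
    "\<And>T x y. related C \<theta>' T x y \<longleftrightarrow> related C \<rho> T x y \<and> related C \<rho> T y x"
    using sim_exists[OF r] by blast
  show rel: "is_relation C \<theta>" and "carrier \<theta> = carrier \<rho>"
    using s unfolding is_sim_def is_meet_def rel_le_def by blast+
  have rel': "is_relation C \<theta>'" using t(1) unfolding is_sim_def is_meet_def by blast
  have "rel_le C \<theta> \<theta>'" "rel_le C \<theta>' \<theta>"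
    using s t(1) unfolding is_sim_def is_meet_def by blast+
  then have "related C \<theta> T x y \<longleftrightarrow> related C \<theta>' T x y"
    using rel_le_related[OF rel rel'] rel_le_related[OF rel' rel] by blast
  with t(2) show "related C \<theta> T x y \<longleftrightarrow> related C \<rho> T x y \<and> related C \<rho> T y x" by simp
qed

lemma preorder_relation: "is_preorder C \<rho> \<Longrightarrow> is_relation C \<rho>"
  by (simp add: is_preorder_def)

lemma preorder_refl:
  "is_preorder C \<rho> \<Longrightarrow> x \<in> Hom C T (carrier \<rho>) \<Longrightarrow> related C \<rho> T x x"
  using reflexive_related unfolding is_preorder_def by blast

lemma preorder_trans:
  "is_preorder C \<rho> \<Longrightarrow> related C \<rho> T x y \<Longrightarrow> related C \<rho> T y z \<Longrightarrow> related C \<rho> T x z"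
  using transitive_related unfolding is_preorder_def by blast

lemma preorderI:
  assumes "is_relation C \<rho>"
    and "\<And>T x. x \<in> Hom C T (carrier \<rho>) \<Longrightarrow> related C \<rho> T x x"
    and "\<And>T x y z. related C \<rho> T x y \<Longrightarrow> related C \<rho> T y z \<Longrightarrow> related C \<rho> T x z"
  shows "is_preorder C \<rho>"
  unfolding is_preorder_def
proof (intro conjI assms(1))
  show "is_reflexive C \<rho>" by (rule reflexiveI[OF relation_typing(3)[OF assms(1)]]) (rule assms(2))
  show "is_transitive C \<rho>" by (rule transitiveI[OF finitely_complete assms(1)]) (rule assms(3))
qed

lemma partial_order_preorder: "is_partial_order C \<rho> \<Longrightarrow> is_preorder C \<rho>"
  by (simp add: is_partial_order_def)

lemma partial_order_antisym:
  assumes "is_partial_order C \<rho>" "related C \<rho> T x y" "related C \<rho> T y x"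
  shows "x = y"
proof -
  have r: "is_relation C \<rho>" using assms(1) by (simp add: is_partial_order_def is_preorder_def)
  have "is_sim C \<rho> (diagonal C (carrier \<rho>))" using assms(1) by (simp add: is_partial_order_def)
  then have "related C (diagonal C (carrier \<rho>)) T x y"
    using sim_related(3)[OF r] assms by blast
  then show ?thesis using related_diagonal related_typing[OF r assms(2)] by blast
qed

text \<open>Antisymmetry of elements puts any relation below \<rho> and its opposite inside the
  diagonal, while reflexivity puts the diagonal below both.\<close>

lemma partial_orderI:
  assumes p: "is_preorder C \<rho>"
    and a: "\<And>T x y. related C \<rho> T x y \<Longrightarrow> related C \<rho> T y x \<Longrightarrow> x = y"
  shows "is_partial_order C \<rho>"
proof -
  note r = preorder_relation[OF p]
  have D: "carrier \<rho> \<in> obj C" using relation_typing[OF r] by blast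
  let ?D = "diagonal C (carrier \<rho>)"
  have Dr: "is_relation C ?D" by (rule diagonal_relation[OF finitely_complete D])
  have c: "carrier ?D = carrier \<rho>" "carrier (opposite \<rho>) = carrier \<rho>"
    by (simp_all add: diagonal_def opposite_def)
  have le: "related C \<rho> T x y \<and> related C \<rho> T y x" if "related C ?D T x y" for T x y
  proof -
    have x: "x \<in> Hom C T (carrier \<rho>)" using related_typing[OF Dr that] c by simp
    then have "x = y" using that related_diagonal by blast
    then show ?thesis using preorder_refl[OF p x] by simp
  qed
  have "is_sim C \<rho> ?D"
    unfolding is_sim_def is_meet_def
  proof (intro conjI allI impI)
    show "is_relation C ?D" by fact
    show "rel_le C ?D \<rho>" by (rule rel_leI[OF Dr c(1)]) (simp add: le)
    show "rel_le C ?D (opposite \<rho>)" by (rule rel_leI[OF Dr]) (simp_all add: le c related_opposite[OF r])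
    fix \<kappa> assume k: "is_relation C \<kappa> \<and> rel_le C \<kappa> \<rho> \<and> rel_le C \<kappa> (opposite \<rho>)"
    then have kc: "carrier \<kappa> = carrier \<rho>" by (auto simp: rel_le_def)
    show "rel_le C \<kappa> ?D"
    proof (rule rel_leI)
      show "is_relation C \<kappa>" "carrier \<kappa> = carrier ?D" using k c kc by auto
      show "related C ?D T x y" if xy: "related C \<kappa> T x y" for T x y
      proof -
        have "x = y"
          using a[of T x y] k xy related_opposite[OF r] rel_le_related[OF _ r, of \<kappa> T x y]
            rel_le_related[OF _ opposite_relation[OF finitely_complete r], of \<kappa> T x y] by blast
        moreover have "x \<in> Hom C T (carrier \<rho>)"
          using related_typing[of \<kappa> T x y] xy k kc by simp
        ultimately show ?thesis using related_diagonal by blast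
      qed
    qed
  qed
  with p show ?thesis by (simp add: is_partial_order_def)
qed

text \<open>Symmetry is built into the meet with the opposite, and the other properties are
  inherited from \<rho>. This makes the effectiveness axiom available for ~.\<close>

lemma sim_equivalence:
  assumes p: "is_preorder C \<rho>" and s: "is_sim C \<rho> \<theta>"
  shows "is_equivalence C \<theta>"
proof -
  note r = preorder_relation[OF p]
  note t = sim_related[OF r s]
  have "is_preorder C \<theta>"
    by (rule preorderI[OF t(1)]) (auto simp: t(2,3) preorder_refl[OF p] intro: preorder_trans[OF p])
  moreover have "is_symmetric C \<theta>"
    unfolding is_symmetric_def
    by (rule rel_leI[OF t(1)]) (simp_all add: related_opposite[OF t(1)] t(3), simp add: opposite_def)
  ultimately show ?thesis unfolding is_equivalence_def is_preorder_def by blast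
qed


section \<open>The quotient of a preorder\<close>

lemma mor_typing:
  assumes "h \<in> Hom (PreOrd C) \<rho> \<sigma>"
  shows "base h \<in> Hom C (carrier \<rho>) (carrier \<sigma>)" "lift h \<in> Hom C (graph C \<rho>) (graph C \<sigma>)"
    "base h \<cdot> fst_proj \<rho> = fst_proj \<sigma> \<cdot> lift h" "base h \<cdot> snd_proj \<rho> = snd_proj \<sigma> \<cdot> lift h"
    "is_preorder C \<rho>" "is_preorder C \<sigma>" "source h = \<rho>" "target h = \<sigma>"
  using assms unfolding Hom_PreOrd is_rel_mor_def by auto

lemma mor_related:
  assumes h: "h \<in> Hom (PreOrd C) \<rho> \<sigma>" and xy: "related C \<rho> T x y"
  shows "related C \<sigma> T (base h \<cdot> x) (base h \<cdot> y)"
proof -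
  note t = mor_typing[OF h]
  note r = relation_typing[OF preorder_relation[OF t(5)]] relation_typing[OF preorder_relation[OF t(6)]]
  obtain a where a: "a \<in> Hom C T (graph C \<rho>)" "fst_proj \<rho> \<cdot> a = x" "snd_proj \<rho> \<cdot> a = y"
    using xy unfolding related_def by blast
  have "fst_proj \<sigma> \<cdot> (lift h \<cdot> a) = base h \<cdot> x"
    using assoc[OF a(1) t(2) r(5)] assoc[OF a(1) r(1) t(1)] t(3) a(2) by simp
  moreover have "snd_proj \<sigma> \<cdot> (lift h \<cdot> a) = base h \<cdot> y"
    using assoc[OF a(1) t(2) r(6)] assoc[OF a(1) r(2) t(1)] t(4) a(3) by simp
  ultimately show ?thesis unfolding related_def using comp_in[OF a(1) t(2)] by blast
qed

text \<open>The lift is no extra data: monotonicity at the generic related pair produces it, and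
  joint monicity makes it unique, as \<open>mor_eqI\<close> shows. Morphisms may thus be treated as
  monotone maps.\<close>

lemma mor_exists:
  assumes "is_preorder C \<rho>" "is_preorder C \<sigma>" "k \<in> Hom C (carrier \<rho>) (carrier \<sigma>)"
    and "\<And>T x y. related C \<rho> T x y \<Longrightarrow> related C \<sigma> T (k \<cdot> x) (k \<cdot> y)"
  obtains h where "h \<in> Hom (PreOrd C) \<rho> \<sigma>" "base h = k"
proof -
  obtain l where "l \<in> Hom C (graph C \<rho>) (graph C \<sigma>)"
    "fst_proj \<sigma> \<cdot> l = k \<cdot> fst_proj \<rho>" "snd_proj \<sigma> \<cdot> l = k \<cdot> snd_proj \<rho>"
    using assms(4)[OF related_universal[OF preorder_relation[OF assms(1)]]] unfolding related_def by blast
  then have "RMor \<rho> \<sigma> k l \<in> Hom (PreOrd C) \<rho> \<sigma>"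
    using assms by (simp add: Hom_PreOrd is_rel_mor_def)
  then show ?thesis using that by force
qed

lemma mor_eqI:
  assumes h: "h \<in> Hom (PreOrd C) \<rho> \<sigma>" and k: "k \<in> Hom (PreOrd C) \<rho> \<sigma>" and b: "base h = base k"
  shows "h = k"
proof -
  note t = mor_typing[OF h] and t' = mor_typing[OF k]
  have "lift h = lift k"
    by (rule relation_eqI[OF preorder_relation[OF t(6)] t(2) t'(2)]) (use t t' b in auto)
  then show ?thesis using b t t' by (cases h; cases k) simp
qed

text \<open>Factor the map from the graph to the square of \<open>B\<close>: the monic part followed
  by the product projections is the image relation, the epic part is its lift.\<close>

lemma ex_regular_image:
  assumes q: "q \<in> Hom C (carrier \<rho>) B" and r: "is_relation C \<rho>"
  obtains \<sigma> e where "is_regular_image C q \<rho> \<sigma> e" "carrier \<sigma> = B"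
proof -
  note rt = relation_typing[OF r]
  have B: "B \<in> obj C" using Hom_obj[OF q] by blast
  obtain P p1 p2 where P: "is_product C B B P p1 p2" using ex_product[OF finitely_complete B B] by blast
  have pt: "p1 \<in> Hom C P B" "p2 \<in> Hom C P B" using P unfolding is_product_def by auto
  obtain g where g: "g \<in> Hom C (graph C \<rho>) P" "p1 \<cdot> g = q \<cdot> fst_proj \<rho>" "p2 \<cdot> g = q \<cdot> snd_proj \<rho>"
    using product_lift[OF P comp_in[OF rt(1) q] comp_in[OF rt(2) q]] by blast
  then obtain e m where em: "is_regular_epi C e" "is_mono C m" "Cod C e = Dom C m" "g = m \<cdot> e"
    using factorization[of g] unfolding Hom_def by blast
  have a: "e \<in> arr C" "m \<in> arr C"
    using em(1,2) unfolding is_regular_epi_def is_coequalizer_def is_mono_def by (auto simp: Hom_def)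
  have e: "e \<in> Hom C (graph C \<rho>) (Dom C m)" "m \<in> Hom C (Dom C m) P"
    using g(1) em(3,4) a by (auto simp: Hom_def)
  let ?\<sigma> = "IRel B (p1 \<cdot> m) (p2 \<cdot> m)"
  have pm: "p1 \<cdot> m \<in> Hom C (Dom C m) B" "p2 \<cdot> m \<in> Hom C (Dom C m) B" using e pt by auto
  have "is_relation C ?\<sigma>"
  proof (rule relationI[OF finitely_complete pm])
    fix T a b assume ab: "a \<in> Hom C T (Dom C m)" "b \<in> Hom C T (Dom C m)"
      and eq: "(p1 \<cdot> m) \<cdot> a = (p1 \<cdot> m) \<cdot> b" "(p2 \<cdot> m) \<cdot> a = (p2 \<cdot> m) \<cdot> b"
    have h: "m \<cdot> a \<in> Hom C T P" "m \<cdot> b \<in> Hom C T P" using ab e by auto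
    have "p1 \<cdot> (m \<cdot> a) = p1 \<cdot> (m \<cdot> b)" "p2 \<cdot> (m \<cdot> a) = p2 \<cdot> (m \<cdot> b)"
      using eq assoc[OF ab(1) e(2) pt(1)] assoc[OF ab(2) e(2) pt(1)]
        assoc[OF ab(1) e(2) pt(2)] assoc[OF ab(2) e(2) pt(2)] by simp_all
    then have "m \<cdot> a = m \<cdot> b"
      using product_lift[OF P comp_in[OF h(1) pt(1)] comp_in[OF h(1) pt(2)]] h by metis
    then show "a = b" using mono_cancel[OF em(2) e(2) ab] by blast
  qed
  then have "is_regular_image C q \<rho> ?\<sigma> e"
    using em(1) e q pm assoc[OF e(1,2) pt(1)] assoc[OF e(1,2) pt(2)] g em(4)
    unfolding is_regular_image_def graph_def by (simp add: Hom_def)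
  then show ?thesis using that by simp
qed

text \<open>Effectiveness gives some \<open>f\<close> with kernel pair \<theta>, not necessarily
  epic. Its regular epic part \<open>e\<close> identifies the same elements, as \<open>m\<close> is
  monic. An arrow coequalizing the projections of \<theta> therefore respects all pairs identified
  by \<open>e\<close> and factors through it.\<close>

lemma canonical_quotient_exists:
  assumes p: "is_preorder C \<rho>"
  obtains h where "is_canonical_quotient C \<rho> h"
proof -
  note r = preorder_relation[OF p]
  obtain \<theta> where s: "is_sim C \<rho> \<theta>" using ex_sim[OF r] by blast
  note t = sim_related[OF r s]
  obtain f where f: "is_kernel_pair C f (fst_proj \<theta>) (snd_proj \<theta>)"
    using equivalence_effective[OF sim_equivalence[OF p s]] by blast
  note tt = relation_typing[OF t(1), unfolded t(2)]
  have pb: "is_pullback C f f (fst_proj \<theta>) (snd_proj \<theta>)" using f by (simp add: is_kernel_pair_def)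
  have D: "Dom C (fst_proj \<theta>) = graph C \<theta>" "Cod C (fst_proj \<theta>) = carrier \<rho>" using tt by (auto simp: Hom_def)
  have "Dom C f = carrier \<rho>" using pullback_typing(1)[OF pb] D by (auto simp: Hom_def)
  moreover have "f \<in> arr C" using pb unfolding is_pullback_def by blast
  ultimately have fH: "f \<in> Hom C (carrier \<rho>) (Cod C f)" by (simp add: Hom_def)
  obtain e m where em: "is_regular_epi C e" "is_mono C m" "Cod C e = Dom C m" "f = m \<cdot> e"
    using factorization[OF \<open>f \<in> arr C\<close>] by blast
  have a: "e \<in> arr C" "m \<in> arr C"
    using em(1,2) unfolding is_regular_epi_def is_coequalizer_def is_mono_def by (auto simp: Hom_def)
  have e: "e \<in> Hom C (carrier \<rho>) (Dom C m)" "m \<in> Hom C (Dom C m) (Cod C f)"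
    using fH em(3,4) a by (auto simp: Hom_def)
  have ee: "e \<cdot> fst_proj \<theta> = e \<cdot> snd_proj \<theta>"
    by (rule mono_cancel[OF em(2) e(2) comp_in[OF tt(1) e(1)] comp_in[OF tt(2) e(1)]])
      (use assoc[OF tt(1) e] assoc[OF tt(2) e] em(4) pullback_typing(3)[OF pb] in simp)
  have "is_coequalizer C (fst_proj \<theta>) (snd_proj \<theta>) e"
    unfolding is_coequalizer_def
  proof (intro conjI ballI impI)
    show "fst_proj \<theta> \<in> arr C" "snd_proj \<theta> \<in> Hom C (Dom C (fst_proj \<theta>)) (Cod C (fst_proj \<theta>))"
      "e \<in> Hom C (Cod C (fst_proj \<theta>)) (Cod C e)" "e \<cdot> fst_proj \<theta> = e \<cdot> snd_proj \<theta>"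
      using tt e ee by (auto simp: Hom_def)
    fix T h assume "h \<in> Hom C (Cod C (fst_proj \<theta>)) T" and eq: "h \<cdot> fst_proj \<theta> = h \<cdot> snd_proj \<theta>"
    then have h: "h \<in> Hom C (carrier \<rho>) T" using D by simp
    obtain k where k: "k \<in> Hom C (Dom C m) T" "k \<cdot> e = h"
    proof (rule regular_epi_factor[OF em(1) e(1) h])
      fix S x y assume xy: "x \<in> Hom C S (carrier \<rho>)" "y \<in> Hom C S (carrier \<rho>)" "e \<cdot> x = e \<cdot> y"
      have "f \<cdot> x = f \<cdot> y"
        using assoc[OF xy(1) e] assoc[OF xy(2) e] em(4) xy(3) by simp
      then obtain z where z: "z \<in> Hom C S (graph C \<theta>)" "fst_proj \<theta> \<cdot> z = x" "snd_proj \<theta> \<cdot> z = y"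
        using pullback_lift[OF pb, of x S y] xy \<open>Dom C f = carrier \<rho>\<close> D by auto
      then show "h \<cdot> x = h \<cdot> y"
        using assoc[OF z(1) tt(1) h] assoc[OF z(1) tt(2) h] eq by simp
    qed
    then show "\<exists>!k. k \<in> Hom C (Cod C e) T \<and> k \<cdot> e = h"
      using regular_epi_cancel[OF em(1) e(1)] em(3) by metis
  qed
  moreover obtain \<sigma> l where "is_regular_image C e \<rho> \<sigma> l"
    using ex_regular_image[OF e(1) r] by blast
  ultimately have "is_canonical_quotient C \<rho> (RMor \<rho> \<sigma> e l)"
    using s unfolding is_canonical_quotient_def by auto
  then show ?thesis using that by blast
qed

context
  fixes \<rho> h
  assumes p: "is_preorder C \<rho>" and cq: "is_canonical_quotient C \<rho> h"
begin

lemma quotient_typing: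
  shows "base h \<in> Hom C (carrier \<rho>) (carrier (target h))" "is_regular_epi C (base h)"
    "is_relation C (target h)" "lift h \<in> Hom C (graph C \<rho>) (graph C (target h))"
    "is_regular_epi C (lift h)" "fst_proj (target h) \<cdot> lift h = base h \<cdot> fst_proj \<rho>"
    "snd_proj (target h) \<cdot> lift h = base h \<cdot> snd_proj \<rho>" "source h = \<rho>"
  using cq unfolding is_canonical_quotient_def is_regular_image_def is_regular_epi_def by blast+

text \<open>A coequalizer of \<theta> might identify more than \<theta> does. Here it cannot:
  \<theta> is the kernel pair of some \<open>f\<close>, and \<open>f\<close> factors through
  \<open>base h\<close>, so elements with equal classes are already equal under
  \<open>f\<close>.\<close>

lemma quotient_eq_related:
  assumes xy: "x \<in> Hom C T (carrier \<rho>)" "y \<in> Hom C T (carrier \<rho>)" "base h \<cdot> x = base h \<cdot> y"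
  shows "related C \<rho> T x y" "related C \<rho> T y x"
proof -
  obtain \<theta> where s: "is_sim C \<rho> \<theta>" and ce: "is_coequalizer C (fst_proj \<theta>) (snd_proj \<theta>) (base h)"
    using cq unfolding is_canonical_quotient_def by blast
  note t = sim_related[OF preorder_relation[OF p] s]
  note tt = relation_typing[OF t(1), unfolded t(2)]
  obtain f where pb: "is_pullback C f f (fst_proj \<theta>) (snd_proj \<theta>)"
    using equivalence_effective[OF sim_equivalence[OF p s]] unfolding is_kernel_pair_def by blast
  have D: "Dom C (fst_proj \<theta>) = graph C \<theta>" "Cod C (fst_proj \<theta>) = carrier \<rho>" using tt by (auto simp: Hom_def)
  have Df: "Dom C f = carrier \<rho>" using pullback_typing(1)[OF pb] D by (auto simp: Hom_def)
  moreover have "f \<in> arr C" using pb unfolding is_pullback_def by blast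
  ultimately have fH: "f \<in> Hom C (carrier \<rho>) (Cod C f)" by (simp add: Hom_def)
  have q: "base h \<in> Hom C (carrier \<rho>) (Cod C (base h))" using quotient_typing(1) by (simp add: Hom_def)
  obtain k where k: "k \<in> Hom C (Cod C (base h)) (Cod C f)" "k \<cdot> base h = f"
    using ce fH Hom_obj[OF fH] pullback_typing(3)[OF pb] D unfolding is_coequalizer_def by metis
  have "f \<cdot> x = f \<cdot> y"
    using assoc[OF xy(1) q k(1)] assoc[OF xy(2) q k(1)] xy(3) k(2) by simp
  then obtain z where "z \<in> Hom C T (graph C \<theta>)" "fst_proj \<theta> \<cdot> z = x" "snd_proj \<theta> \<cdot> z = y"
    using pullback_lift[OF pb, of x T y] xy Df D by auto
  then have "related C \<theta> T x y" unfolding related_def by blast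
  then show "related C \<rho> T x y" "related C \<rho> T y x" using t(3) by blast+
qed

text \<open>The order of the quotient is an image, so \<open>lift h\<close> is a regular
  epimorphism; a witness over \<open>T\<close> has a local preimage in the graph of \<rho>, whose
  endpoints are \<open>x\<close> and \<open>y\<close>.\<close>

lemma quotient_related_lift:
  assumes "related C (target h) T b b'"
  obtains T' c x y where "is_regular_epi C c" "c \<in> Hom C T' T" "related C \<rho> T' x y"
    "base h \<cdot> x = b \<cdot> c" "base h \<cdot> y = b' \<cdot> c"
proof -
  note q = quotient_typing
  note r = relation_typing[OF preorder_relation[OF p]] and s = relation_typing[OF q(3)]
  obtain a where a: "a \<in> Hom C T (graph C (target h))" "fst_proj (target h) \<cdot> a = b" "snd_proj (target h) \<cdot> a = b'"
    using assms unfolding related_def by blast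
  obtain T' c z where c: "is_regular_epi C c" "c \<in> Hom C T' T" "z \<in> Hom C T' (graph C \<rho>)" "lift h \<cdot> z = a \<cdot> c"
    by (rule regular_epi_lift[OF q(5,4) a(1)])
  have "base h \<cdot> (fst_proj \<rho> \<cdot> z) = b \<cdot> c"
    using assoc[OF c(3) r(1) q(1)] assoc[OF c(3) q(4) s(1)] assoc[OF c(2) a(1) s(1)] q(6) c(4) a(2) by simp
  moreover have "base h \<cdot> (snd_proj \<rho> \<cdot> z) = b' \<cdot> c"
    using assoc[OF c(3) r(2) q(1)] assoc[OF c(3) q(4) s(2)] assoc[OF c(2) a(1) s(2)] q(7) c(4) a(3) by simp
  moreover have "related C \<rho> T' (fst_proj \<rho> \<cdot> z) (snd_proj \<rho> \<cdot> z)" unfolding related_def using c(3) by blast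
  ultimately show ?thesis using that c by blast
qed

lemma quotient_related_image:
  assumes "related C \<rho> T x y"
  shows "related C (target h) T (base h \<cdot> x) (base h \<cdot> y)"
proof -
  note q = quotient_typing
  note r = relation_typing[OF preorder_relation[OF p]] and s = relation_typing[OF q(3)]
  obtain a where a: "a \<in> Hom C T (graph C \<rho>)" "fst_proj \<rho> \<cdot> a = x" "snd_proj \<rho> \<cdot> a = y"
    using assms unfolding related_def by blast
  have "fst_proj (target h) \<cdot> (lift h \<cdot> a) = base h \<cdot> x"
    using assoc[OF a(1) q(4) s(1)] assoc[OF a(1) r(1) q(1)] q(6) a(2) by simp
  moreover have "snd_proj (target h) \<cdot> (lift h \<cdot> a) = base h \<cdot> y"
    using assoc[OF a(1) q(4) s(2)] assoc[OF a(1) r(2) q(1)] q(7) a(3) by simp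
  ultimately show ?thesis unfolding related_def using comp_in[OF a(1) q(4)] by blast
qed

text \<open>Lift the relation locally to a related pair \<open>u\<close>, \<open>v\<close>. The
  given elements are equivalent to \<open>u\<close> and \<open>v\<close> by
  \<open>quotient_eq_related\<close>, so transitivity links them on the cover, and membership
  descends.\<close>

lemma quotient_related_reflect:
  assumes xy: "x \<in> Hom C T (carrier \<rho>)" "y \<in> Hom C T (carrier \<rho>)"
    and rel: "related C (target h) T (base h \<cdot> x) (base h \<cdot> y)"
  shows "related C \<rho> T x y"
proof -
  note q = quotient_typing
  note r = preorder_relation[OF p]
  obtain T' c u v where c: "is_regular_epi C c" "c \<in> Hom C T' T" and uv: "related C \<rho> T' u v"
    "base h \<cdot> u = (base h \<cdot> x) \<cdot> c" "base h \<cdot> v = (base h \<cdot> y) \<cdot> c"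
    by (rule quotient_related_lift[OF rel])
  have e: "base h \<cdot> (x \<cdot> c) = base h \<cdot> u" "base h \<cdot> v = base h \<cdot> (y \<cdot> c)"
    using uv assoc[OF c(2) xy(1) q(1)] assoc[OF c(2) xy(2) q(1)] by simp_all
  note ut = related_typing[OF r uv(1)]
  have "related C \<rho> T' (x \<cdot> c) u" "related C \<rho> T' v (y \<cdot> c)"
    using quotient_eq_related(1) e ut xy c by blast+
  then have "related C \<rho> T' (x \<cdot> c) (y \<cdot> c)"
    using uv(1) preorder_trans[OF p] by blast
  then show ?thesis using related_descent[OF r c xy] by blast
qed

lemma quotient_partial_order: "is_partial_order C (target h)"
proof (rule partial_orderI)
  note q = quotient_typing
  note r = preorder_relation[OF p]
  let ?\<tau> = "target h" and ?q = "base h"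
  show "is_preorder C ?\<tau>"
  proof (rule preorderI[OF q(3)])
    fix T b assume b: "b \<in> Hom C T (carrier ?\<tau>)"
    obtain T' c x where c: "is_regular_epi C c" "c \<in> Hom C T' T" "x \<in> Hom C T' (carrier \<rho>)" "?q \<cdot> x = b \<cdot> c"
      by (rule regular_epi_lift[OF q(2,1) b])
    have "related C ?\<tau> T' (b \<cdot> c) (b \<cdot> c)"
      using quotient_related_image[OF preorder_refl[OF p c(3)]] c(4) by simp
    then show "related C ?\<tau> T b b" using related_descent[OF q(3) c(1,2) b b] by blast
  next
    fix T b1 b2 b3 assume b: "related C ?\<tau> T b1 b2" "related C ?\<tau> T b2 b3"
    note bt = related_typing[OF q(3) b(1)] related_typing[OF q(3) b(2)]
    obtain T' c x y where c: "is_regular_epi C c" "c \<in> Hom C T' T" and xy: "related C \<rho> T' x y"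
      "?q \<cdot> x = b1 \<cdot> c" "?q \<cdot> y = b2 \<cdot> c"
      by (rule quotient_related_lift[OF b(1)])
    note xt = related_typing[OF r xy(1)]
    \<comment> \<open>Only \<open>b3\<close> needs a new lift: reflection turns the second relation
      into one between the already chosen \<open>y\<close> and \<open>z\<close>, so the two can be
      composed in \<rho>.\<close>
    obtain S d z where d: "is_regular_epi C d" "d \<in> Hom C S T'" "z \<in> Hom C S (carrier \<rho>)" "?q \<cdot> z = (b3 \<cdot> c) \<cdot> d"
      by (rule regular_epi_lift[OF q(2,1) comp_in[OF c(2) bt(4)]])
    have "related C ?\<tau> S ((b2 \<cdot> c) \<cdot> d) ((b3 \<cdot> c) \<cdot> d)"
      using related_comp[OF q(3) related_comp[OF q(3) b(2) c(2)] d(2)] .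
    then have "related C ?\<tau> S (?q \<cdot> (y \<cdot> d)) (?q \<cdot> z)"
      using assoc[OF d(2) xt(2) q(1)] xy(3) d(4) by simp
    then have "related C \<rho> S (y \<cdot> d) z"
      using quotient_related_reflect comp_in[OF d(2) xt(2)] d(3) by blast
    then have "related C \<rho> S (x \<cdot> d) z"
      using preorder_trans[OF p] related_comp[OF r xy(1) d(2)] by blast
    from quotient_related_image[OF this] have "related C ?\<tau> S ((b1 \<cdot> c) \<cdot> d) ((b3 \<cdot> c) \<cdot> d)"
      using assoc[OF d(2) xt(1) q(1)] xy(2) d(4) by simp
    then have "related C ?\<tau> T' (b1 \<cdot> c) (b3 \<cdot> c)"
      using related_descent[OF q(3) d(1,2)] comp_in[OF c(2) bt(1)] comp_in[OF c(2) bt(4)] by blast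
    then show "related C ?\<tau> T b1 b3" using related_descent[OF q(3) c bt(1,4)] by blast
  qed
  fix T b b' assume b: "related C ?\<tau> T b b'" "related C ?\<tau> T b' b"
  note bt = related_typing[OF q(3) b(1)]
  obtain T' c x y where c: "is_regular_epi C c" "c \<in> Hom C T' T" and xy: "related C \<rho> T' x y"
    "?q \<cdot> x = b \<cdot> c" "?q \<cdot> y = b' \<cdot> c"
    by (rule quotient_related_lift[OF b(1)])
  note xt = related_typing[OF r xy(1)]
  have "related C ?\<tau> T' (?q \<cdot> y) (?q \<cdot> x)"
    using related_comp[OF q(3) b(2) c(2)] xy by simp
  then have yx: "related C \<rho> T' y x" using quotient_related_reflect xt by blast
  \<comment> \<open>Now \<open>x\<close> and \<open>y\<close> are related both ways, hence form an
    element of \<theta>, which \<open>?q\<close> coequalizes.\<close>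
  obtain \<theta> where s: "is_sim C \<rho> \<theta>" and ce: "is_coequalizer C (fst_proj \<theta>) (snd_proj \<theta>) ?q"
    using cq unfolding is_canonical_quotient_def by blast
  note t = sim_related[OF r s]
  note tt = relation_typing[OF t(1), unfolded t(2)]
  obtain z where z: "z \<in> Hom C T' (graph C \<theta>)" "fst_proj \<theta> \<cdot> z = x" "snd_proj \<theta> \<cdot> z = y"
    using t(3) xy(1) yx unfolding related_def by metis
  have "?q \<cdot> fst_proj \<theta> = ?q \<cdot> snd_proj \<theta>" using ce unfolding is_coequalizer_def by blast
  then have "?q \<cdot> x = ?q \<cdot> y"
    using assoc[OF z(1) tt(1) q(1)] assoc[OF z(1) tt(2) q(1)] z by simp
  then show "b = b'" using regular_epi_cancel[OF c bt] xy by simp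
qed

lemma quotient_mor: "h \<in> Hom (PreOrd C) \<rho> (target h)"
  using quotient_typing p partial_order_preorder[OF quotient_partial_order]
  by (simp add: Hom_PreOrd is_rel_mor_def)

text \<open>Elements with equal classes are equivalent, so a monotone map to a partial order takes
  equal values on them and factors through \<open>base h\<close>. The factor is monotone because
  related classes have related local representatives. Everything else is settled on bases.\<close>

lemma quotient_universal:
  assumes W: "is_partial_order C W" and g: "g \<in> Hom (PreOrd C) \<rho> W"
  shows "\<exists>!k. k \<in> Hom (PreOrd C) (target h) W \<and> k \<cdot>\<^bsub>PreOrd C\<^esub> h = g"
proof -
  note q = quotient_typing and gt = mor_typing[OF g]
  note r = preorder_relation[OF p]
  note Wr = preorder_relation[OF gt(6)]
  obtain k0 where k0: "k0 \<in> Hom C (carrier (target h)) (carrier W)" "k0 \<cdot> base h = base g"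
  proof (rule regular_epi_factor[OF q(2,1) gt(1)])
    fix T s t assume st: "s \<in> Hom C T (carrier \<rho>)" "t \<in> Hom C T (carrier \<rho>)" "base h \<cdot> s = base h \<cdot> t"
    show "base g \<cdot> s = base g \<cdot> t"
      using partial_order_antisym[OF W] mor_related[OF g] quotient_eq_related[OF st] by blast
  qed
  obtain k where k: "k \<in> Hom (PreOrd C) (target h) W" "base k = k0"
  proof (rule mor_exists[OF partial_order_preorder[OF quotient_partial_order] gt(6) k0(1)])
    fix T b b' assume b: "related C (target h) T b b'"
    note bt = related_typing[OF q(3) b]
    obtain T' c x y where c: "is_regular_epi C c" "c \<in> Hom C T' T" and xy: "related C \<rho> T' x y"
      "base h \<cdot> x = b \<cdot> c" "base h \<cdot> y = b' \<cdot> c"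
      by (rule quotient_related_lift[OF b])
    note xt = related_typing[OF r xy(1)]
    have "base g \<cdot> x = (k0 \<cdot> b) \<cdot> c" "base g \<cdot> y = (k0 \<cdot> b') \<cdot> c"
      using assoc[OF c(2) bt(1) k0(1)] assoc[OF c(2) bt(2) k0(1)]
        assoc[OF xt(1) q(1) k0(1)] assoc[OF xt(2) q(1) k0(1)] xy k0(2) by simp_all
    then have "related C W T' ((k0 \<cdot> b) \<cdot> c) ((k0 \<cdot> b') \<cdot> c)"
      using mor_related[OF g xy(1)] by simp
    then show "related C W T (k0 \<cdot> b) (k0 \<cdot> b')"
      using related_descent[OF Wr c] comp_in[OF bt(1) k0(1)] comp_in[OF bt(2) k0(1)] by blast
  qed
  interpret P: category "PreOrd C" by (rule category_PreOrd) (rule category_axioms)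
  show ?thesis
  proof (rule ex1I[of _ k])
    show "k \<in> Hom (PreOrd C) (target h) W \<and> k \<cdot>\<^bsub>PreOrd C\<^esub> h = g"
      using k k0 g P.comp_in[OF quotient_mor k(1)] by (auto intro: mor_eqI simp: PreOrd_simps)
    fix l assume l: "l \<in> Hom (PreOrd C) (target h) W \<and> l \<cdot>\<^bsub>PreOrd C\<^esub> h = g"
    then have lt: "base l \<in> Hom C (carrier (target h)) (carrier W)" "base l \<cdot> base h = base g"
      using mor_typing(1) by (auto simp: PreOrd_simps)
    then have "base l = k0" using regular_epi_cancel[OF q(2,1)] k0 by metis
    then show "l = k" using mor_eqI l k by blast
  qed
qed

end


section \<open>Transport of the quotient along isomorphisms and identification of the unit\<close>

lemma coequalizer_iso:
  assumes ce: "is_coequalizer C u v q" and q: "q \<in> Hom C A B"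
    and k: "k \<in> Hom C B D" and k': "k' \<in> Hom C D B" "k' \<cdot> k = ident C B" "k \<cdot> k' = ident C D"
  shows "is_coequalizer C u v (k \<cdot> q)"
proof -
  have uv: "u \<in> Hom C (Dom C u) A" "v \<in> Hom C (Dom C u) A" "q \<cdot> u = q \<cdot> v" "Cod C u = A" "Cod C q = B"
    using ce q unfolding is_coequalizer_def by (auto simp: Hom_def)
  have kq: "k \<cdot> q \<in> Hom C A D" "Cod C (k \<cdot> q) = D" using comp_in[OF q k] by (auto simp: Hom_def)
  have re: "is_regular_epi C q" using ce unfolding is_regular_epi_def by blast
  show ?thesis
    unfolding is_coequalizer_def uv(4) kq(2)
  proof (intro conjI ballI impI)
    show "u \<in> arr C" using uv(1) by (simp add: Hom_def)
    show "v \<in> Hom C (Dom C u) A" "k \<cdot> q \<in> Hom C A D" by fact+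
    show "(k \<cdot> q) \<cdot> u = (k \<cdot> q) \<cdot> v" using assoc[OF uv(1) q k] assoc[OF uv(2) q k] uv(3) by simp
    fix T h assume h: "T \<in> obj C" "h \<in> Hom C A T" "h \<cdot> u = h \<cdot> v"
    then obtain l where l: "l \<in> Hom C B T" "l \<cdot> q = h"
      using ce unfolding is_coequalizer_def uv(4,5) by blast
    show "\<exists>!l. l \<in> Hom C D T \<and> l \<cdot> (k \<cdot> q) = h"
    proof (rule ex1I[of _ "l \<cdot> k'"])
      show "l \<cdot> k' \<in> Hom C D T \<and> (l \<cdot> k') \<cdot> (k \<cdot> q) = h"
        using assoc[OF kq(1) k'(1) l(1)] assoc[OF q k k'(1)] k'(2) ident_left[OF q] l comp_in[OF k'(1) l(1)] by simp
      fix l' assume l': "l' \<in> Hom C D T \<and> l' \<cdot> (k \<cdot> q) = h"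
      then have "(l' \<cdot> k) \<cdot> q = l \<cdot> q" using assoc[OF q k, of l' T] l by simp
      then have "l' \<cdot> k = l" using regular_epi_cancel[OF re q] l' k l by blast
      then show "l' = l \<cdot> k'" using assoc[OF k'(1) k, of l' T] l' k'(3) ident_right[of l' D T] by simp
    qed
  qed
qed

text \<open>An isomorphism of preorders is invertible on carriers and on graphs separately. So
  \<open>coequalizer_iso\<close> serves twice: for the base, and for the lift, whose being regular
  epic is again a coequalizer claim.\<close>

lemma canonical_quotient_iso:
  assumes p: "is_preorder C \<rho>" and cq: "is_canonical_quotient C \<rho> h"
    and k: "k \<in> Hom (PreOrd C) (target h) \<tau>" and k': "k' \<in> Hom (PreOrd C) \<tau> (target h)"
    and i: "k' \<cdot>\<^bsub>PreOrd C\<^esub> k = ident (PreOrd C) (target h)" "k \<cdot>\<^bsub>PreOrd C\<^esub> k' = ident (PreOrd C) \<tau>"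
  shows "is_canonical_quotient C \<rho> (k \<cdot>\<^bsub>PreOrd C\<^esub> h)"
proof -
  note q = quotient_typing[OF p cq]
  note kt = mor_typing[OF k] and kt' = mor_typing[OF k']
  note s = relation_typing[OF q(3)]
  note t = relation_typing[OF preorder_relation[OF kt(6)]]
  have bi: "base k' \<cdot> base k = ident C (carrier (target h))" "base k \<cdot> base k' = ident C (carrier \<tau>)"
    "lift k' \<cdot> lift k = ident C (graph C (target h))" "lift k \<cdot> lift k' = ident C (graph C \<tau>)"
    using i by (simp_all add: PreOrd_simps)
  obtain \<theta> where "is_sim C \<rho> \<theta>" "is_coequalizer C (fst_proj \<theta>) (snd_proj \<theta>) (base h)"
    using cq unfolding is_canonical_quotient_def by blast
  then have c1: "\<exists>\<theta>. is_sim C \<rho> \<theta> \<and> is_coequalizer C (fst_proj \<theta>) (snd_proj \<theta>) (base k \<cdot> base h)"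
    using coequalizer_iso[OF _ q(1) kt(1) kt'(1) bi(1,2)] by blast
  have re: "is_regular_epi C (lift k \<cdot> lift h)"
    using q(5) coequalizer_iso[OF _ q(4) kt(2) kt'(2) bi(3,4)] unfolding is_regular_epi_def by blast
  note r = relation_typing[OF preorder_relation[OF p]]
  have "is_regular_image C (base k \<cdot> base h) \<rho> \<tau> (lift k \<cdot> lift h)"
    unfolding is_regular_image_def
  proof (intro conjI re)
    show "base k \<cdot> base h \<in> Hom C (carrier \<rho>) (carrier \<tau>)" using q kt by auto
    show "lift k \<cdot> lift h \<in> Hom C (graph C \<rho>) (graph C \<tau>)" using q kt by auto
    show "is_relation C \<tau>" by (rule preorder_relation[OF kt(6)])
    show "fst_proj \<tau> \<cdot> (lift k \<cdot> lift h) = (base k \<cdot> base h) \<cdot> fst_proj \<rho>"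
      using assoc[OF q(4) kt(2) t(1)] assoc[OF r(1) q(1) kt(1)] assoc[OF q(4) s(1) kt(1)] kt(3) q(6) by simp
    show "snd_proj \<tau> \<cdot> (lift k \<cdot> lift h) = (base k \<cdot> base h) \<cdot> snd_proj \<rho>"
      using assoc[OF q(4) kt(2) t(2)] assoc[OF r(2) q(1) kt(1)] assoc[OF q(4) s(2) kt(1)] kt(4) q(7) by simp
  qed
  with c1 show ?thesis using q(8) kt(8) unfolding is_canonical_quotient_def by (simp add: PreOrd_simps)
qed

lemma category_preorders: "category (PreOrd C)"
  by (rule category_PreOrd) (rule category_axioms)

lemma unit_canonical_quotient:
  assumes adj: "left_adjoint (PreOrd C) (ParOrd C) F inclusion \<eta>" and p: "is_preorder C \<rho>"
  shows "is_canonical_quotient C \<rho> (\<eta> \<rho>)"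
proof -
  interpret P: category "PreOrd C" by (rule category_preorders)
  obtain h where cq: "is_canonical_quotient C \<rho> h" by (rule canonical_quotient_exists[OF p])
  note u = quotient_partial_order[OF p cq] quotient_universal[OF p cq]
  obtain k k' where "k \<in> Hom (PreOrd C) (target h) (on_obj F \<rho>)" "k' \<in> Hom (PreOrd C) (on_obj F \<rho>) (target h)"
    "k \<cdot>\<^bsub>PreOrd C\<^esub> h = \<eta> \<rho>" "k' \<cdot>\<^bsub>PreOrd C\<^esub> k = ident (PreOrd C) (target h)"
    "k \<cdot>\<^bsub>PreOrd C\<^esub> k' = ident (PreOrd C) (on_obj F \<rho>)"
  proof (rule P.universal_arrow_iso_unit[OF adj[unfolded ParOrd_def] quotient_mor[OF p cq]])
    show "target h \<in> obj (PreOrd C) \<inter> {\<rho>. is_partial_order C \<rho>}"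
      using u(1) partial_order_preorder by (simp add: PreOrd_simps)
  qed (use u(2) in auto)
  then show ?thesis using canonical_quotient_iso[OF p cq] by metis
qed

section \<open>Pullbacks along the quotient\<close>

lemma diagonal_preorder:
  assumes "T \<in> obj C"
  shows "is_preorder C (diagonal C T)"
proof (rule preorderI)
  show r: "is_relation C (diagonal C T)" by (rule diagonal_relation[OF finitely_complete assms])
  have c: "carrier (diagonal C T) = T" by (simp add: diagonal_def)
  show "related C (diagonal C T) S x x" if "x \<in> Hom C S (carrier (diagonal C T))" for S x
    using that related_diagonal c by simp
  show "related C (diagonal C T) S x z"
    if "related C (diagonal C T) S x y" "related C (diagonal C T) S y z" for S x y z
    using that related_typing[OF r that(1), unfolded c] related_diagonal by metis
qed

text \<open>Reflexivity makes every map out of a discrete preorder monotone. Generalized elements of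
  a carrier thereby become morphisms of preorders, to which universal properties in
  \<open>PreOrd C\<close> apply.\<close>

lemma discrete_mor_exists:
  assumes p: "is_preorder C \<rho>" and u: "u \<in> Hom C T (carrier \<rho>)"
  obtains h where "h \<in> Hom (PreOrd C) (diagonal C T) \<rho>" "base h = u"
proof (rule mor_exists[OF diagonal_preorder p])
  have c: "carrier (diagonal C T) = T" by (simp add: diagonal_def)
  show T: "T \<in> obj C" using Hom_obj[OF u] by simp
  show "u \<in> Hom C (carrier (diagonal C T)) (carrier \<rho>)" using u c by simp
  fix S x y assume xy: "related C (diagonal C T) S x y"
  have x: "x \<in> Hom C S T" using related_typing[OF diagonal_relation[OF finitely_complete T] xy] c by simp
  then show "related C \<rho> S (u \<cdot> x) (u \<cdot> y)"
    using xy related_diagonal[OF x] preorder_refl[OF p comp_in[OF x u]] by simp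
qed (use that in blast)

text \<open>The forgetful functor has the discrete preorders as left adjoint, so it preserves
  limits. Concretely, both halves of the universal property are tested at
  \<open>diagonal C T\<close>.\<close>

lemma preord_pullback_base:
  assumes f: "f \<in> Hom (PreOrd C) \<rho> \<tau>" and g: "g \<in> Hom (PreOrd C) \<sigma> \<tau>"
    and pb: "is_pullback (PreOrd C) f g p q"
  shows "is_pullback C (base f) (base g) (base p) (base q)"
    "p \<in> Hom (PreOrd C) (source p) \<rho>" "q \<in> Hom (PreOrd C) (source p) \<sigma>"
proof -
  interpret P: category "PreOrd C" by (rule category_preorders)
  note ft = mor_typing[OF f] and gt = mor_typing[OF g]
  have d: "Dom (PreOrd C) f = \<rho>" "Dom (PreOrd C) g = \<sigma>" "Dom (PreOrd C) p = source p"
    using ft gt by (auto simp: PreOrd_simps)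
  show p: "p \<in> Hom (PreOrd C) (source p) \<rho>" and q: "q \<in> Hom (PreOrd C) (source p) \<sigma>"
    using P.pullback_typing[OF pb] d by auto
  note pt = mor_typing[OF p] and qt = mor_typing[OF q]
  have base_comp: "base (k \<cdot>\<^bsub>PreOrd C\<^esub> h) = base k \<cdot> base h" for k h by (simp add: PreOrd_simps)
  show "is_pullback C (base f) (base g) (base p) (base q)"
  proof (rule pullbackI[OF ft(1) gt(1) pt(1) qt(1)])
    show "base f \<cdot> base p = base g \<cdot> base q"
      using P.pullback_typing(3)[OF pb] base_comp by metis
    fix T
    {
      fix u v assume u: "u \<in> Hom C T (carrier \<rho>)" and v: "v \<in> Hom C T (carrier \<sigma>)"
        and uv: "base f \<cdot> u = base g \<cdot> v"
      obtain u' where u': "u' \<in> Hom (PreOrd C) (diagonal C T) \<rho>" "base u' = u"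
        by (rule discrete_mor_exists[OF ft(5) u])
      obtain v' where v': "v' \<in> Hom (PreOrd C) (diagonal C T) \<sigma>" "base v' = v"
        by (rule discrete_mor_exists[OF gt(5) v])
      have "f \<cdot>\<^bsub>PreOrd C\<^esub> u' = g \<cdot>\<^bsub>PreOrd C\<^esub> v'"
        by (rule mor_eqI[OF P.comp_in[OF u'(1) f] P.comp_in[OF v'(1) g]]) (simp add: base_comp u' v' uv)
      then obtain h where h: "h \<in> Hom (PreOrd C) (diagonal C T) (source p)"
        "p \<cdot>\<^bsub>PreOrd C\<^esub> h = u'" "q \<cdot>\<^bsub>PreOrd C\<^esub> h = v'"
        using P.pullback_lift[OF pb, unfolded d, OF u'(1) v'(1)] by blast
      have "base h \<in> Hom C T (carrier (source p))" using mor_typing(1)[OF h(1)] by (simp add: diagonal_def)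
      moreover have "base p \<cdot> base h = u" "base q \<cdot> base h = v" using h u' v' base_comp by metis+
      ultimately show "\<exists>h\<in>Hom C T (carrier (source p)). base p \<cdot> h = u \<and> base q \<cdot> h = v" by blast
    }
    fix h k assume h: "h \<in> Hom C T (carrier (source p))" and k: "k \<in> Hom C T (carrier (source p))"
      and eq: "base p \<cdot> h = base p \<cdot> k" "base q \<cdot> h = base q \<cdot> k"
    obtain h' where h': "h' \<in> Hom (PreOrd C) (diagonal C T) (source p)" "base h' = h"
      by (rule discrete_mor_exists[OF pt(5) h])
    obtain k' where k': "k' \<in> Hom (PreOrd C) (diagonal C T) (source p)" "base k' = k"
      by (rule discrete_mor_exists[OF pt(5) k])
    have "p \<cdot>\<^bsub>PreOrd C\<^esub> h' = p \<cdot>\<^bsub>PreOrd C\<^esub> k'"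
      by (rule mor_eqI[OF P.comp_in[OF h'(1) p] P.comp_in[OF k'(1) p]]) (simp add: base_comp h' k' eq)
    moreover have "q \<cdot>\<^bsub>PreOrd C\<^esub> h' = q \<cdot>\<^bsub>PreOrd C\<^esub> k'"
      by (rule mor_eqI[OF P.comp_in[OF h'(1) q] P.comp_in[OF k'(1) q]]) (simp add: base_comp h' k' eq)
    ultimately have "h' = k'"
      using P.pullback_unique[OF pb, unfolded d, OF h'(1) k'(1)] by blast
    then show "h = k" using h' k' by simp
  qed
qed

text \<open>The pairs in \<open>\<rho> \<times>\<^sub>\<tau> \<sigma>\<close> form a preorder on the underlying pullback which maps to
  both factors, so by the universal property it is contained in the order of the given pullback.\<close>

lemma preord_pullback_related:
  assumes f: "f \<in> Hom (PreOrd C) \<rho> \<tau>" and g: "g \<in> Hom (PreOrd C) \<sigma> \<tau>"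
    and pb: "is_pullback (PreOrd C) f g p q"
    and u: "u \<in> Hom C T (carrier (source p))" and v: "v \<in> Hom C T (carrier (source p))"
    and rel: "related C \<rho> T (base p \<cdot> u) (base p \<cdot> v)" "related C \<sigma> T (base q \<cdot> u) (base q \<cdot> v)"
  shows "related C (source p) T u v"
proof -
  interpret P: category "PreOrd C" by (rule category_preorders)
  note ft = mor_typing[OF f] and gt = mor_typing[OF g]
  note bpb = preord_pullback_base[OF f g pb]
  note pt = mor_typing[OF bpb(2)] and qt = mor_typing[OF bpb(3)]
  note \<rho> = preorder_relation[OF ft(5)] and \<sigma> = preorder_relation[OF gt(5)] and \<tau> = preorder_relation[OF ft(6)]
  note \<rho>t = relation_typing[OF \<rho>] and \<sigma>t = relation_typing[OF \<sigma>] and \<tau>t = relation_typing[OF \<tau>]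
  let ?P = "carrier (source p)"
  have d: "Dom C (base f) = carrier \<rho>" "Dom C (base g) = carrier \<sigma>" "Dom C (base p) = ?P"
    "Dom C (lift f) = graph C \<rho>" "Dom C (lift g) = graph C \<sigma>"
    using ft(1,2) gt(1,2) pt(1) by (auto simp: Hom_def)
  \<comment> \<open>The graph of the competing preorder: pairs of witnesses in \<rho> and \<sigma>
    that lie over the same witness in \<tau>. Below, \<open>s1\<close> and \<open>s2\<close> send
    such a pair to its two endpoints in the underlying pullback.\<close>
  obtain a b where ab: "is_pullback C (lift f) (lift g) a b"
    using ex_pullback[OF finitely_complete ft(2) gt(2)] by blast
  note at = pullback_typing[OF ab, unfolded d]
  let ?R = "Dom C a"
  have "base f \<cdot> (fst_proj \<rho> \<cdot> a) = base g \<cdot> (fst_proj \<sigma> \<cdot> b)"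
    using assoc[OF at(1) \<rho>t(1) ft(1)] assoc[OF at(1) ft(2) \<tau>t(1)] ft(3)
      assoc[OF at(2) \<sigma>t(1) gt(1)] assoc[OF at(2) gt(2) \<tau>t(1)] gt(3) at(3) by simp
  then obtain s1 where s1: "s1 \<in> Hom C ?R ?P" "base p \<cdot> s1 = fst_proj \<rho> \<cdot> a" "base q \<cdot> s1 = fst_proj \<sigma> \<cdot> b"
    by (rule pullback_lift[OF bpb(1), unfolded d, OF comp_in[OF at(1) \<rho>t(1)] comp_in[OF at(2) \<sigma>t(1)]])
  have "base f \<cdot> (snd_proj \<rho> \<cdot> a) = base g \<cdot> (snd_proj \<sigma> \<cdot> b)"
    using assoc[OF at(1) \<rho>t(2) ft(1)] assoc[OF at(1) ft(2) \<tau>t(2)] ft(4)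
      assoc[OF at(2) \<sigma>t(2) gt(1)] assoc[OF at(2) gt(2) \<tau>t(2)] gt(4) at(3) by simp
  then obtain s2 where s2: "s2 \<in> Hom C ?R ?P" "base p \<cdot> s2 = snd_proj \<rho> \<cdot> a" "base q \<cdot> s2 = snd_proj \<sigma> \<cdot> b"
    by (rule pullback_lift[OF bpb(1), unfolded d, OF comp_in[OF at(1) \<rho>t(2)] comp_in[OF at(2) \<sigma>t(2)]])
  define \<kappa> where "\<kappa> = IRel ?P s1 s2"
  have \<kappa>: "carrier \<kappa> = ?P" "graph C \<kappa> = ?R" "fst_proj \<kappa> = s1" "snd_proj \<kappa> = s2"
    using s1(1) by (auto simp: \<kappa>_def graph_def Hom_def)
  have rt: "fst_proj \<rho> \<cdot> (a \<cdot> z) = base p \<cdot> (s1 \<cdot> z)" "snd_proj \<rho> \<cdot> (a \<cdot> z) = base p \<cdot> (s2 \<cdot> z)"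
    "fst_proj \<sigma> \<cdot> (b \<cdot> z) = base q \<cdot> (s1 \<cdot> z)" "snd_proj \<sigma> \<cdot> (b \<cdot> z) = base q \<cdot> (s2 \<cdot> z)"
    if z: "z \<in> Hom C S ?R" for z S
    using assoc[OF z at(1) \<rho>t(1)] assoc[OF z at(1) \<rho>t(2)] assoc[OF z at(2) \<sigma>t(1)] assoc[OF z at(2) \<sigma>t(2)]
      assoc[OF z s1(1) pt(1)] assoc[OF z s1(1) qt(1)] assoc[OF z s2(1) pt(1)] assoc[OF z s2(1) qt(1)] s1 s2
    by simp_all
  have rel\<kappa>: "is_relation C \<kappa>"
    unfolding \<kappa>_def
  proof (rule relationI[OF finitely_complete s1(1) s2(1)])
    fix S x y assume x: "x \<in> Hom C S ?R" and y: "y \<in> Hom C S ?R" and eq: "s1 \<cdot> x = s1 \<cdot> y" "s2 \<cdot> x = s2 \<cdot> y"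
    show "x = y"
    proof (rule pullback_unique[OF ab x y])
      show "a \<cdot> x = a \<cdot> y"
        by (rule relation_eqI[OF \<rho> comp_in[OF x at(1)] comp_in[OF y at(1)]])
          (use rt(1,2)[OF x] rt(1,2)[OF y] eq in simp_all)
      show "b \<cdot> x = b \<cdot> y"
        by (rule relation_eqI[OF \<sigma> comp_in[OF x at(2)] comp_in[OF y at(2)]])
          (use rt(3,4)[OF x] rt(3,4)[OF y] eq in simp_all)
    qed
  qed
  have rel_iff: "related C \<kappa> S x y \<longleftrightarrow> related C \<rho> S (base p \<cdot> x) (base p \<cdot> y) \<and> related C \<sigma> S (base q \<cdot> x) (base q \<cdot> y)"
    if x: "x \<in> Hom C S ?P" and y: "y \<in> Hom C S ?P" for S x y
  proof
    assume "related C \<kappa> S x y"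
    then obtain z where z: "z \<in> Hom C S ?R" "s1 \<cdot> z = x" "s2 \<cdot> z = y" unfolding related_def \<kappa> by blast
    show "related C \<rho> S (base p \<cdot> x) (base p \<cdot> y) \<and> related C \<sigma> S (base q \<cdot> x) (base q \<cdot> y)"
      unfolding related_def using rt[OF z(1)] z comp_in[OF z(1) at(1)] comp_in[OF z(1) at(2)] by blast
  next
    assume "related C \<rho> S (base p \<cdot> x) (base p \<cdot> y) \<and> related C \<sigma> S (base q \<cdot> x) (base q \<cdot> y)"
    then obtain c e where c: "c \<in> Hom C S (graph C \<rho>)" "fst_proj \<rho> \<cdot> c = base p \<cdot> x" "snd_proj \<rho> \<cdot> c = base p \<cdot> y"
      and e: "e \<in> Hom C S (graph C \<sigma>)" "fst_proj \<sigma> \<cdot> e = base q \<cdot> x" "snd_proj \<sigma> \<cdot> e = base q \<cdot> y"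
      unfolding related_def by blast
    have bpbt: "base f \<cdot> base p = base g \<cdot> base q" by (rule pullback_typing(3)[OF bpb(1)])
    have sq: "base f \<cdot> (base p \<cdot> w) = base g \<cdot> (base q \<cdot> w)" if "w \<in> Hom C S ?P" for w
      using assoc[OF that pt(1) ft(1)] assoc[OF that qt(1) gt(1)] bpbt by simp
    \<comment> \<open>Both sides witness the same related pair of \<tau>, since the square of bases
      commutes on \<open>x\<close> and on \<open>y\<close>; joint monicity leaves only one such
      witness.\<close>
    have "lift f \<cdot> c = lift g \<cdot> e"
    proof (rule relation_eqI[OF \<tau> comp_in[OF c(1) ft(2)] comp_in[OF e(1) gt(2)]])
      show "fst_proj \<tau> \<cdot> (lift f \<cdot> c) = fst_proj \<tau> \<cdot> (lift g \<cdot> e)"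
        using assoc[OF c(1) ft(2) \<tau>t(1)] assoc[OF c(1) \<rho>t(1) ft(1)] ft(3) c(2) sq[OF x]
          assoc[OF e(1) gt(2) \<tau>t(1)] assoc[OF e(1) \<sigma>t(1) gt(1)] gt(3) e(2) by simp
      show "snd_proj \<tau> \<cdot> (lift f \<cdot> c) = snd_proj \<tau> \<cdot> (lift g \<cdot> e)"
        using assoc[OF c(1) ft(2) \<tau>t(2)] assoc[OF c(1) \<rho>t(2) ft(1)] ft(4) c(3) sq[OF y]
          assoc[OF e(1) gt(2) \<tau>t(2)] assoc[OF e(1) \<sigma>t(2) gt(1)] gt(4) e(3) by simp
    qed
    then obtain z where z: "z \<in> Hom C S ?R" "a \<cdot> z = c" "b \<cdot> z = e"
      by (rule pullback_lift[OF ab, unfolded d, OF c(1) e(1)])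
    have "s1 \<cdot> z = x"
      by (rule pullback_unique[OF bpb(1), unfolded d, OF comp_in[OF z(1) s1(1)] x])
        (use rt[OF z(1)] z c e in simp_all)
    moreover have "s2 \<cdot> z = y"
      by (rule pullback_unique[OF bpb(1), unfolded d, OF comp_in[OF z(1) s2(1)] y])
        (use rt[OF z(1)] z c e in simp_all)
    ultimately show "related C \<kappa> S x y" unfolding related_def \<kappa> using z(1) by blast
  qed
  have po: "is_preorder C \<kappa>"
  proof (rule preorderI[OF rel\<kappa>])
    show "related C \<kappa> S x x" if "x \<in> Hom C S (carrier \<kappa>)" for S x
    proof -
      have x: "x \<in> Hom C S ?P" using that \<kappa> by simp
      show ?thesis
        using rel_iff[OF x x] preorder_refl[OF ft(5) comp_in[OF x pt(1)]]
          preorder_refl[OF gt(5) comp_in[OF x qt(1)]] by blast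
    qed
    show "related C \<kappa> S x z" if xy: "related C \<kappa> S x y" and yz: "related C \<kappa> S y z" for S x y z
    proof -
      note t = related_typing[OF rel\<kappa> xy, unfolded \<kappa>] related_typing[OF rel\<kappa> yz, unfolded \<kappa>]
      show ?thesis
        using rel_iff[OF t(1,2)] rel_iff[OF t(2,4)] rel_iff[OF t(1,4)] xy yz
          preorder_trans[OF ft(5)] preorder_trans[OF gt(5)] by blast
    qed
  qed
  obtain p' where p': "p' \<in> Hom (PreOrd C) \<kappa> \<rho>" "base p' = base p"
  proof (rule mor_exists[OF po ft(5)])
    show "base p \<in> Hom C (carrier \<kappa>) (carrier \<rho>)" using pt(1) \<kappa> by simp
    show "related C \<rho> S (base p \<cdot> x) (base p \<cdot> y)" if "related C \<kappa> S x y" for S x y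
      using rel_iff[OF related_typing[OF rel\<kappa> that, unfolded \<kappa>]] that by blast
  qed
  obtain q' where q': "q' \<in> Hom (PreOrd C) \<kappa> \<sigma>" "base q' = base q"
  proof (rule mor_exists[OF po gt(5)])
    show "base q \<in> Hom C (carrier \<kappa>) (carrier \<sigma>)" using qt(1) \<kappa> by simp
    show "related C \<sigma> S (base q \<cdot> x) (base q \<cdot> y)" if "related C \<kappa> S x y" for S x y
      using rel_iff[OF related_typing[OF rel\<kappa> that, unfolded \<kappa>]] that by blast
  qed
  have bc: "base (k \<cdot>\<^bsub>PreOrd C\<^esub> h) = base k \<cdot> base h" for k h by (simp add: PreOrd_simps)
  have d': "Dom (PreOrd C) f = \<rho>" "Dom (PreOrd C) g = \<sigma>" "Dom (PreOrd C) p = source p"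
    using ft gt by (auto simp: PreOrd_simps)
  have "f \<cdot>\<^bsub>PreOrd C\<^esub> p' = g \<cdot>\<^bsub>PreOrd C\<^esub> q'"
    by (rule mor_eqI[OF P.comp_in[OF p'(1) f] P.comp_in[OF q'(1) g]])
      (simp add: bc p' q' pullback_typing(3)[OF bpb(1)])
  then obtain h where h: "h \<in> Hom (PreOrd C) \<kappa> (source p)" "p \<cdot>\<^bsub>PreOrd C\<^esub> h = p'" "q \<cdot>\<^bsub>PreOrd C\<^esub> h = q'"
    by (rule P.pullback_lift[OF pb, unfolded d', OF p'(1) q'(1)])
  have hb: "base h \<in> Hom C ?P ?P" using mor_typing(1)[OF h(1)] \<kappa> by simp
  have i: "ident C ?P \<in> Hom C ?P ?P" using Hom_obj[OF hb] by simp
  \<comment> \<open>As \<kappa> lives on the same carrier and \<open>h\<close> commutes with both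
    projections, its base is the identity; monotonicity of \<open>h\<close> is then exactly
    containment of \<kappa> in the order of \<open>source p\<close>.\<close>
  have "base h = ident C ?P"
  proof (rule pullback_unique[OF bpb(1), unfolded d, OF hb i])
    show "base p \<cdot> base h = base p \<cdot> ident C ?P" using h(2) p'(2) bc ident_right[OF pt(1)] by metis
    show "base q \<cdot> base h = base q \<cdot> ident C ?P" using h(3) q'(2) bc ident_right[OF qt(1)] by metis
  qed
  moreover have "related C \<kappa> T u v" using rel_iff[OF u v] rel by blast
  ultimately show ?thesis
    using mor_related[OF h(1), of T u v] ident_left[OF u] ident_left[OF v] by simp
qed

section \<open>Extension of monotone maps along a pullback of the quotient\<close>

context
  fixes X Z h f p q
  assumes X: "is_preorder C X" and cq: "is_canonical_quotient C X h"
    and f: "f \<in> Hom (PreOrd C) Z (target h)" and pb: "is_pullback (PreOrd C) h f p q"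
begin

lemma quotient_pullback_regular_epi: "is_regular_epi C (base q)"
  using preord_pullback_base(1)[OF quotient_mor[OF X cq] f pb] quotient_typing(2)[OF X cq]
  by (rule regular_epi_stable)

text \<open>A morphism is determined by its base, and the base of \<open>q\<close> is epic, being a
  pullback of the regular epimorphism \<open>base h\<close>.\<close>

lemma quotient_pullback_cancel:
  assumes u: "u \<in> Hom (PreOrd C) Z W" and v: "v \<in> Hom (PreOrd C) Z W"
    and eq: "u \<cdot>\<^bsub>PreOrd C\<^esub> q = v \<cdot>\<^bsub>PreOrd C\<^esub> q"
  shows "u = v"
proof -
  have "base u \<cdot> base q = base v \<cdot> base q" using eq by (simp add: PreOrd_simps)
  then have "base u = base v"
    using regular_epi_cancel[OF quotient_pullback_regular_epi]
      mor_typing(1)[OF preord_pullback_base(3)[OF quotient_mor[OF X cq] f pb]]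
      mor_typing(1)[OF u] mor_typing(1)[OF v] by blast
  then show ?thesis using mor_eqI u v by blast
qed

text \<open>Two elements of the pullback with the same image in \<open>Z\<close> have equivalent components in \<open>X\<close>,
  hence are equivalent, so a partial order cannot separate them.\<close>

lemma quotient_pullback_factor:
  assumes W: "is_partial_order C W" and g: "g \<in> Hom (PreOrd C) (source p) W"
  obtains k where "k \<in> Hom (PreOrd C) Z W" "k \<cdot>\<^bsub>PreOrd C\<^esub> q = g"
proof -
  interpret P: category "PreOrd C" by (rule category_preorders)
  note hm = quotient_mor[OF X cq]
  note bpb = preord_pullback_base[OF hm f pb]
  note ht = mor_typing[OF hm] and ft = mor_typing[OF f] and gt = mor_typing[OF g]
  note pt = mor_typing[OF bpb(2)] and qt = mor_typing[OF bpb(3)]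
  note qe = quotient_typing[OF X cq]
  note Zr = preorder_relation[OF ft(5)] and Xr = preorder_relation[OF X] and Wr = preorder_relation[OF gt(6)]
  note Zt = relation_typing[OF Zr] and Xt = relation_typing[OF Xr] and Tt = relation_typing[OF qe(3)]
  let ?P = "carrier (source p)"
  have d: "Dom C (base h) = carrier X" "Dom C (base f) = carrier Z" "Dom C (base p) = ?P"
    using ht(1) ft(1) pt(1) by (auto simp: Hom_def)
  have sq: "base h \<cdot> (base p \<cdot> w) = base f \<cdot> (base q \<cdot> w)" if "w \<in> Hom C S ?P" for w S
    using assoc[OF that pt(1) ht(1)] assoc[OF that qt(1) ft(1)] pullback_typing(3)[OF bpb(1)] by simp
  obtain k0 where k0: "k0 \<in> Hom C (carrier Z) (carrier W)" "k0 \<cdot> base q = base g"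
  proof (rule regular_epi_factor[OF quotient_pullback_regular_epi qt(1) gt(1)])
    fix T u v assume uv: "u \<in> Hom C T ?P" "v \<in> Hom C T ?P" and eq: "base q \<cdot> u = base q \<cdot> v"
    have "base h \<cdot> (base p \<cdot> u) = base h \<cdot> (base p \<cdot> v)" using sq[OF uv(1)] sq[OF uv(2)] eq by simp
    then have X': "related C X T (base p \<cdot> u) (base p \<cdot> v)" "related C X T (base p \<cdot> v) (base p \<cdot> u)"
      using quotient_eq_related[OF X cq comp_in[OF uv(1) pt(1)] comp_in[OF uv(2) pt(1)]] by blast+
    \<comment> \<open>The components in \<open>Z\<close> coincide, so reflexivity suffices
      there.\<close>
    have Z': "related C Z T (base q \<cdot> u) (base q \<cdot> v)" "related C Z T (base q \<cdot> v) (base q \<cdot> u)"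
      using preorder_refl[OF ft(5) comp_in[OF uv(2) qt(1)]] eq by simp_all
    have "related C (source p) T u v" "related C (source p) T v u"
      using preord_pullback_related[OF hm f pb uv X'(1) Z'(1)]
        preord_pullback_related[OF hm f pb uv(2,1) X'(2) Z'(2)] by blast+
    then show "base g \<cdot> u = base g \<cdot> v"
      using partial_order_antisym[OF W] mor_related[OF g] by blast
  qed
  obtain k where k: "k \<in> Hom (PreOrd C) Z W" "base k = k0"
  proof (rule mor_exists[OF ft(5) gt(6) k0(1)])
    fix T x y assume xy: "related C Z T x y"
    note xyt = related_typing[OF Zr xy]
    \<comment> \<open>Monotonicity of \<open>f\<close> moves the relation into the quotient of
      \<open>X\<close>, where it has a local lift. Pairing \<open>x'\<close> and \<open>y'\<close>
      with the restrictions of \<open>x\<close> and \<open>y\<close> gives the elements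
      \<open>u\<close> and \<open>v\<close> of the pullback, related in both components.\<close>
    obtain T' c x' y' where c: "is_regular_epi C c" "c \<in> Hom C T' T" and xy': "related C X T' x' y'"
      "base h \<cdot> x' = (base f \<cdot> x) \<cdot> c" "base h \<cdot> y' = (base f \<cdot> y) \<cdot> c"
      by (rule quotient_related_lift[OF X cq mor_related[OF f xy]])
    note xyt' = related_typing[OF Xr xy'(1)]
    have "base h \<cdot> x' = base f \<cdot> (x \<cdot> c)" "base h \<cdot> y' = base f \<cdot> (y \<cdot> c)"
      using xy' assoc[OF c(2) xyt(1) ft(1)] assoc[OF c(2) xyt(2) ft(1)] by simp_all
    note sq' = this
    obtain u where u: "u \<in> Hom C T' ?P" "base p \<cdot> u = x'" "base q \<cdot> u = x \<cdot> c"
      by (rule pullback_lift[OF bpb(1), unfolded d, OF xyt'(1) comp_in[OF c(2) xyt(1)] sq'(1)])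
    obtain v where v: "v \<in> Hom C T' ?P" "base p \<cdot> v = y'" "base q \<cdot> v = y \<cdot> c"
      by (rule pullback_lift[OF bpb(1), unfolded d, OF xyt'(2) comp_in[OF c(2) xyt(2)] sq'(2)])
    have "related C (source p) T' u v"
      by (rule preord_pullback_related[OF hm f pb u(1) v(1)])
        (use u v xy'(1) related_comp[OF Zr xy c(2)] in simp_all)
    from mor_related[OF g this] have "related C W T' (base g \<cdot> u) (base g \<cdot> v)" .
    moreover have "base g \<cdot> u = (k0 \<cdot> x) \<cdot> c" "base g \<cdot> v = (k0 \<cdot> y) \<cdot> c"
      using assoc[OF u(1) qt(1) k0(1)] assoc[OF v(1) qt(1) k0(1)] u v k0(2)
        assoc[OF c(2) xyt(1) k0(1)] assoc[OF c(2) xyt(2) k0(1)] by simp_all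
    ultimately show "related C W T (k0 \<cdot> x) (k0 \<cdot> y)"
      using related_descent[OF Wr c comp_in[OF xyt(1) k0(1)] comp_in[OF xyt(2) k0(1)]] by simp
  qed
  have "k \<cdot>\<^bsub>PreOrd C\<^esub> q = g"
    by (rule mor_eqI[OF P.comp_in[OF bpb(3) k(1)] g]) (simp add: PreOrd_simps k(2) k0(2))
  with k(1) show ?thesis using that by blast
qed

end

end

theorem theorem1p7:
  fixes C :: "('o, 'a) cat"
    and F :: "(('o, 'a) irel, ('o, 'a) rel_mor, ('o, 'a) irel, ('o, 'a) rel_mor) ftor"
    and \<eta> :: "('o, 'a) irel \<Rightarrow> ('o, 'a) rel_mor"
  assumes "exact_category C"
    and "left_adjoint (PreOrd C) (ParOrd C) F inclusion \<eta>"
  shows "(\<forall>X\<in>obj (PreOrd C). is_canonical_quotient C X (\<eta> X)) \<and>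
         has_stable_units (PreOrd C) (ParOrd C) F \<eta>"
proof -
  interpret exact_category C by fact
  interpret P: category "PreOrd C" by (rule category_preorders)
  note adj = assms(2)[unfolded ParOrd_def]
  have cq: "is_canonical_quotient C X (\<eta> X)" if "X \<in> obj (PreOrd C)" for X
    using unit_canonical_quotient[OF assms(2)] that by (simp add: PreOrd_simps)
  have "is_pullback (ParOrd C) (on_arr F (\<eta> X)) (on_arr F f) (on_arr F p) (on_arr F q)"
    if X: "X \<in> obj (PreOrd C)" and f: "f \<in> Hom (PreOrd C) Z (on_obj F X)"
      and pb: "is_pullback (PreOrd C) (\<eta> X) f p q" for X Z f p q
    unfolding ParOrd_def
  proof (rule P.reflector_preserves_pullback[OF adj X f pb])
    have X': "is_preorder C X" using X by (simp add: PreOrd_simps)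
    \<comment> \<open>The codomain of \<open>\<eta> X\<close> is \<open>on_obj F X\<close>, so
      \<open>f\<close> is an arrow into the target of a canonical quotient, the form needed by the
      lemmas on pullbacks.\<close>
    have f': "f \<in> Hom (PreOrd C) Z (target (\<eta> X))"
      using f P.unit_in[OF adj X] by (simp add: Hom_PreOrd)
    show "u = v" if "u \<in> Hom (PreOrd C) Z W" "v \<in> Hom (PreOrd C) Z W"
      "u \<cdot>\<^bsub>PreOrd C\<^esub> q = v \<cdot>\<^bsub>PreOrd C\<^esub> q" for W u v
      by (rule quotient_pullback_cancel[OF X' cq[OF X] f' pb that])
    show "\<exists>k\<in>Hom (PreOrd C) Z W. k \<cdot>\<^bsub>PreOrd C\<^esub> q = g"
      if W: "W \<in> {\<rho>. is_partial_order C \<rho>}" and g: "g \<in> Hom (PreOrd C) (Dom (PreOrd C) p) W" for W g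
    proof -
      have "is_partial_order C W" "g \<in> Hom (PreOrd C) (source p) W" using W g by (simp_all add: PreOrd_simps)
      then show ?thesis by (rule quotient_pullback_factor[OF X' cq[OF X] f' pb]) blast
    qed
  qed
  then have "has_stable_units (PreOrd C) (ParOrd C) F \<eta>"
    unfolding has_stable_units_def preserves_pullback_of_def by blast
  with cq show ?thesis by blast
qed

end
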